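(* Let $B\subset\mathbb{R}_+$ be any compact set. Then the following hold. (a) For any $\varepsilon>0$, $\lim_{N\to\infty}\sup_{\theta_0\in B}\mathbb{P}\big(|\widehat\theta_N^{\mathrm{MLE}}-\theta_0|>\varepsilon\big)=0$. (b) Uniformly in $\theta_0\in B$, $\sqrt{I_N}\big(\widehat\theta_N^{\mathrm{MLE}}-\theta_0\big)$ converges in distribution to $\mathcal{N}(0,1)$ as $N\to\infty$. (c) For any $\varepsilon>0$, $\lim_{N\to\infty}\sup_{\theta_0\in B}\mathbb{P}\big(\big|\sqrt{I_N}(\widehat\theta_N^{\mathrm{MLE}}-\theta_0)-\xi_N\big|>\varepsilon\big)=0$. (d) For any $\varpi\in\mathbf{W}_p$, $\widehat\theta_N^{\mathrm{MLE}}$ is asymptotically efficient in $B$ for the loss functions $\varpi_N(x):=\varpi(\sqrt{I_N}x)$; that is, for any $\theta_0\in B$, $$\lim_{\delta\to0+}\liminf_{N\to\infty}\sup_{|\theta-\theta_0|<\delta}\mathbb{E}\big(\varpi_N(\widehat\theta_N^{\mathrm{MLE}}-\theta)\big)=\mathbb{E}(\varpi(\xi)),$$ where $\xi\sim\mathcal{N}(0,1)$ under $\mathbb{P}$.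
   Context: $\mathbb{R}_+:=(0,\infty)$. $(\Omega,\mathscr{F},\{\mathscr{F}_t\},\mathbb{P})$ is a stochastic basis satisfying the usual assumptions, with independent standard Brownian motions $\{w_k\}_{k\in\mathbb{N}}$. $\{\mu_k\}\subset(0,\infty)$ with $\mu_k\to\infty$ (the eigenvalues of a positive definite self-adjoint operator $A$ on a separable Hilbert space), $\{q_k\}\subset(0,\infty)$, $\sigma>0$ and $T>0$ are fixed and known. For $\theta\in\mathbb{R}_+$, $u_k^\theta$ is the $k$-th Fourier mode of the solution of $du+\theta Au\,dt=\sigma\sum_ku_kh_kq_k\,dw_k$ ($h_k$ the eigenvectors of $A$), i.e. $du_k^\theta=-\theta\mu_ku_k^\theta\,dt+\sigma q_ku_k^\theta\,dw_k$, so $u_k^\theta(t)=u_k(0)\exp\big(-(\theta\mu_k+\tfrac12\sigma^2q_k^2)t+\sigma q_kw_k(t)\big)$, $t\in[0,T]$, with $\mathscr{F}_0$-measurable $u_k(0)\ne0$ not depending on $\theta$. Standing assumption: the well-posedness condition of the equation holds for at least one parameter value, i.e. there exist $\bar\theta>0$, $N_0\in\mathbb{N}$, $c>0$ with $2\bar\theta-\sigma^2q_k^2/\mu_k\ge c$ for all $k\ge N_0$. $\theta_0\in\mathbb{R}_+$ is the true parameter value and the observation is $U_N=U_N^{\theta_0}=(u_1,\dots,u_N)$ on $[0,T]$, $u_k:=u_k^{\theta_0}$. The Fisher information is $I_N:=\frac{T}{\sigma^2}\sum_{k=1}^N\mu_k^2q_k^{-2}$. Put $$\widehat\theta_N:=-\frac{\sum_{k=1}^N\mu_kq_k^{-2}\int_0^T\frac{du_k(t)}{u_k(t)}}{T\sum_{k=1}^N\mu_k^2q_k^{-2}},\qquad\widehat\theta_N^{\mathrm{MLE}}:=\mathbf{1}_{\{\widehat\theta_N\in\mathbb{R}_+\}}\widehat\theta_N,\qquad\xi_N:=-\frac{1}{\sigma\sqrt{I_N}}\sum_{k=1}^N\mu_kq_k^{-1}w_k(T).$$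 In suprema over $\theta_0$ (resp. over $\theta$ in (d), where $\theta\in\mathbb{R}_+$), the estimator is computed from data generated under that parameter value ($U_N^{\theta_0}$, resp. $U_N^{\theta}$). "Converges in distribution uniformly in $\theta_0\in B$" means that for every bounded continuous $g$, $\sup_{\theta_0\in B}|\mathbb{E}g(\cdot)-\mathbb{E}g(\xi)|\to0$, $\xi\sim\mathcal{N}(0,1)$. $\mathbf{W}$ is the set of Borel measurable $\ell:\mathbb{R}\to[0,\infty)$ that are symmetric, non-decreasing on $[0,\infty)$, with $\ell(0)=0$, continuous at $0$ and not identically $0$; $\mathbf{W}_p$ is the set of $\ell\in\mathbf{W}$ possessing a polynomial majorant as $|x|\to\infty$. *)

theory Defs
  imports "HOL-Probability.Probability" "HOL-Computational_Algebra.Polynomial"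
begin

section \<open>Stochastic bases and Brownian motions\<close>

text \<open>Only the sigma-algebras \<open>F t\<close> with \<open>t \<ge> 0\<close> are relevant. The usual assumptions are the
  completeness of the space, right-continuity, and that \<open>F 0\<close> contains all null sets.\<close>

locale stochastic_basis = prob_space M + complete_measure M
  for M :: "'a measure" +
  fixes F :: "real \<Rightarrow> 'a measure"
  assumes subalgebra_F: "\<And>t. 0 \<le> t \<Longrightarrow> subalgebra M (F t)"
    and mono_F: "\<And>s t. 0 \<le> s \<Longrightarrow> s \<le> t \<Longrightarrow> sets (F s) \<subseteq> sets (F t)"
    and right_continuous_F: "\<And>t. 0 \<le> t \<Longrightarrow> sets (F t) = (\<Inter>s\<in>{t<..}. sets (F s))"
    and null_sets_F: "null_sets M \<subseteq> sets (F 0)"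

definition (in stochastic_basis) brownian_motion :: "(real \<Rightarrow> 'a \<Rightarrow> real) \<Rightarrow> bool" where
  "brownian_motion w \<longleftrightarrow>
    (\<forall>t\<ge>0. w t \<in> borel_measurable (F t)) \<and>
    (AE \<omega> in M. w 0 \<omega> = 0) \<and>
    (AE \<omega> in M. continuous_on {0..} (\<lambda>t. w t \<omega>)) \<and>
    (\<forall>s\<ge>0. \<forall>t>s.
      distributed M lborel (\<lambda>\<omega>. w t \<omega> - w s \<omega>) (normal_density 0 (sqrt (t - s))) \<and>
      indep_set (sets (F s)) {(\<lambda>\<omega>. w t \<omega> - w s \<omega>) -` A \<inter> space M | A. A \<in> sets borel})"

text \<open>Independence of the family \<open>w\<close> is independence of the whole processes, viewed as random
  elements of the product space of paths.\<close>

definition (in stochastic_basis) indep_brownian_motions ::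
    "nat set \<Rightarrow> (nat \<Rightarrow> real \<Rightarrow> 'a \<Rightarrow> real) \<Rightarrow> bool" where
  "indep_brownian_motions K w \<longleftrightarrow>
    (\<forall>k\<in>K. brownian_motion (w k)) \<and>
    indep_vars (\<lambda>_. \<Pi>\<^sub>M t\<in>{0..}. borel) (\<lambda>k \<omega>. \<lambda>t\<in>{0..}. w k t \<omega>) K"

section \<open>Stochastic integrals\<close>

definition partition_points :: "real \<Rightarrow> nat \<Rightarrow> (nat \<Rightarrow> real) \<Rightarrow> bool" where
  "partition_points T n p \<longleftrightarrow> p 0 = 0 \<and> p n = T \<and> (\<forall>i<n. p i < p (Suc i))"

text \<open>For a continuous semimartingale \<open>X\<close> and a continuous adapted \<open>H\<close>, the Ito integral of \<open>H\<close>
  against \<open>X\<close> over \<open>[0, T]\<close> is the limit in probability of the Riemann sums with integrand evaluated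
  at left endpoints, as the mesh of the partition tends to zero.\<close>

definition has_ito_integral ::
    "'a measure \<Rightarrow> real \<Rightarrow> (real \<Rightarrow> 'a \<Rightarrow> real) \<Rightarrow> (real \<Rightarrow> 'a \<Rightarrow> real) \<Rightarrow> ('a \<Rightarrow> real) \<Rightarrow> bool" where
  "has_ito_integral M T H X J \<longleftrightarrow>
    (\<forall>t\<in>{0..T}. H t \<in> borel_measurable M \<and> X t \<in> borel_measurable M) \<and>
    J \<in> borel_measurable M \<and>
    (\<forall>\<epsilon>>0. \<forall>\<eta>>0. \<exists>\<delta>>0. \<forall>n p.
      partition_points T n p \<and> (\<forall>i<n. p (Suc i) - p i < \<delta>) \<longrightarrow>
      measure M {\<omega> \<in> space M.
        \<bar>(\<Sum>i<n. H (p i) \<omega> * (X (p (Suc i)) \<omega> - X (p i) \<omega>)) - J \<omega>\<bar> > \<epsilon>} < \<eta>)"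

text \<open>The integral is determined up to a null set (lemma \<open>has_ito_integral_unique\<close>); the choice
  operator picks one version.\<close>

definition ito_integral ::
    "'a measure \<Rightarrow> real \<Rightarrow> (real \<Rightarrow> 'a \<Rightarrow> real) \<Rightarrow> (real \<Rightarrow> 'a \<Rightarrow> real) \<Rightarrow> 'a \<Rightarrow> real" where
  "ito_integral M T H X = (SOME J. has_ito_integral M T H X J)"

lemma partition_points_exists:
  assumes "T > 0" "\<delta> > 0"
  shows "\<exists>n p. partition_points T n p \<and> (\<forall>i<n. p (Suc i) - p i < \<delta>)"
proof -
  obtain n :: nat where n: "T / \<delta> < real n" using reals_Archimedean2 by blast
  have npos: "real n > 0" using n assms by (meson divide_pos_pos less_trans)
  define p where "p i = real i * (T / real n)" for i
  have step: "p (Suc i) - p i = T / real n" for i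
    by (simp add: p_def algebra_simps add_divide_distrib)
  have "T / real n < \<delta>" using n npos assms by (simp add: field_simps)
  moreover have "T / real n > 0" using npos assms by simp
  then have "p i < p (Suc i)" for i using step[of i] by linarith
  moreover have "p 0 = 0" "p n = T" using npos by (simp_all add: p_def)
  ultimately have "partition_points T n p \<and> (\<forall>i<n. p (Suc i) - p i < \<delta>)"
    using step by (simp add: partition_points_def)
  then show ?thesis by blast
qed

lemma has_ito_integralD:
  assumes "has_ito_integral M T H X J"
  shows "J \<in> borel_measurable M"
    and "t \<in> {0..T} \<Longrightarrow> H t \<in> borel_measurable M"
    and "t \<in> {0..T} \<Longrightarrow> X t \<in> borel_measurable M"
    and "\<epsilon> > 0 \<Longrightarrow> \<eta> > 0 \<Longrightarrow> \<exists>\<delta>>0. \<forall>n p.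
      partition_points T n p \<and> (\<forall>i<n. p (Suc i) - p i < \<delta>) \<longrightarrow>
      measure M {\<omega> \<in> space M.
        \<bar>(\<Sum>i<n. H (p i) \<omega> * (X (p (Suc i)) \<omega> - X (p i) \<omega>)) - J \<omega>\<bar> > \<epsilon>} < \<eta>"
  using assms unfolding has_ito_integral_def by simp_all

lemma has_ito_integral_unique:
  assumes "prob_space M" "T > 0" and J: "has_ito_integral M T H X J" "has_ito_integral M T H X J'"
  shows "AE \<omega> in M. J \<omega> = J' \<omega>"
proof -
  interpret prob_space M by fact
  have [measurable]: "J \<in> borel_measurable M" "J' \<in> borel_measurable M"
    by (fact has_ito_integralD(1)[OF J(1)] has_ito_integralD(1)[OF J(2)])+
  have small: "measure M {\<omega> \<in> space M. \<bar>J \<omega> - J' \<omega>\<bar> > 2 * e} < 2 * h"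
    if e: "e > 0" and h: "h > 0" for e h :: real
  proof -
    let ?S = "\<lambda>n p \<omega>. \<Sum>i<n. H (p i) \<omega> * (X (p (Suc i)) \<omega> - X (p i) \<omega>)"
    obtain d1 where d1: "d1 > 0" "\<forall>n p. partition_points T n p \<and> (\<forall>i<n. p (Suc i) - p i < d1) \<longrightarrow>
        measure M {\<omega> \<in> space M. \<bar>?S n p \<omega> - J \<omega>\<bar> > e} < h"
      using has_ito_integralD(4)[OF J(1) e h] by (elim exE conjE)
    obtain d2 where d2: "d2 > 0" "\<forall>n p. partition_points T n p \<and> (\<forall>i<n. p (Suc i) - p i < d2) \<longrightarrow>
        measure M {\<omega> \<in> space M. \<bar>?S n p \<omega> - J' \<omega>\<bar> > e} < h"
      using has_ito_integralD(4)[OF J(2) e h] by (elim exE conjE)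
    obtain n p where np: "partition_points T n p" "\<forall>i<n. p (Suc i) - p i < min d1 d2"
      using partition_points_exists[of T "min d1 d2"] assms(2) d1(1) d2(1) by auto
    have incr: "p i \<le> p j" if "i \<le> j" "j \<le> n" for i j
      using that
    proof (induction j rule: dec_induct)
      case (step m)
      then have "p m < p (Suc m)" using np(1) by (simp add: partition_points_def)
      with step show ?case by simp
    qed simp
    have rng: "p i \<in> {0..T}" if "i \<le> n" for i
      using incr[of 0 i] incr[of i n] that np(1) by (auto simp: partition_points_def)
    have [measurable]: "?S n p \<in> borel_measurable M"
    proof (intro borel_measurable_sum borel_measurable_times borel_measurable_diff)
      fix i assume "i \<in> {..<n}"
      then have "p i \<in> {0..T}" "p (Suc i) \<in> {0..T}" using rng by auto
      then show "H (p i) \<in> borel_measurable M" "X (p (Suc i)) \<in> borel_measurable M"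
        "X (p i) \<in> borel_measurable M"
        by (auto intro: has_ito_integralD(2,3)[OF J(1)])
    qed
    let ?A = "{\<omega> \<in> space M. \<bar>?S n p \<omega> - J \<omega>\<bar> > e}"
    let ?B = "{\<omega> \<in> space M. \<bar>?S n p \<omega> - J' \<omega>\<bar> > e}"
    have "measure M {\<omega> \<in> space M. \<bar>J \<omega> - J' \<omega>\<bar> > 2 * e} \<le> measure M (?A \<union> ?B)"
    proof (intro finite_measure_mono subsetI)
      fix \<omega> assume "\<omega> \<in> {\<omega> \<in> space M. \<bar>J \<omega> - J' \<omega>\<bar> > 2 * e}"
      then have "\<omega> \<in> space M" "\<bar>J \<omega> - J' \<omega>\<bar> > 2 * e" by simp_all
      moreover from this(2) have "\<bar>?S n p \<omega> - J \<omega>\<bar> > e \<or> \<bar>?S n p \<omega> - J' \<omega>\<bar> > e" by linarith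
      ultimately show "\<omega> \<in> ?A \<union> ?B" by simp
    qed measurable
    also have "\<dots> \<le> measure M ?A + measure M ?B" by (intro measure_Un_le) measurable
    also have "\<dots> < h + h"
      using np(2)
      by (intro add_strict_mono d1(2)[rule_format] d2(2)[rule_format] conjI np(1)) simp_all
    also have "h + h = 2 * h" by simp
    finally show ?thesis .
  qed
  have "AE \<omega> in M. \<not> \<bar>J \<omega> - J' \<omega>\<bar> > 2 * inverse (real (Suc m))" for m
  proof -
    have "measure M {\<omega> \<in> space M. \<bar>J \<omega> - J' \<omega>\<bar> > 2 * inverse (real (Suc m))} \<le> 0"
    proof (rule field_le_epsilon)
      fix h :: real assume "h > 0"
      then show "measure M {\<omega> \<in> space M. \<bar>J \<omega> - J' \<omega>\<bar> > 2 * inverse (real (Suc m))} \<le> 0 + h"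
        using small[of "inverse (real (Suc m))" "h / 2"] by simp
    qed
    then have "measure M {\<omega> \<in> space M. \<bar>J \<omega> - J' \<omega>\<bar> > 2 * inverse (real (Suc m))} = 0"
      using measure_nonneg antisym by blast
    then show ?thesis by (subst AE_iff_measurable[OF _ refl]) (auto simp: emeasure_eq_measure)
  qed
  then have "AE \<omega> in M. \<forall>m. \<not> \<bar>J \<omega> - J' \<omega>\<bar> > 2 * inverse (real (Suc m))"
    by (simp add: AE_all_countable)
  then show ?thesis
  proof eventually_elim
    case (elim \<omega>)
    show ?case
    proof (rule ccontr)
      assume "J \<omega> \<noteq> J' \<omega>"
      then have "\<bar>J \<omega> - J' \<omega>\<bar> / 2 > 0" by simp
      then obtain m where "inverse (real (Suc m)) < \<bar>J \<omega> - J' \<omega>\<bar> / 2"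
        using reals_Archimedean by blast
      with elim show False by (simp add: mult.commute less_divide_eq)
    qed
  qed
qed

section \<open>The statistical model\<close>

text \<open>All sequences are indexed by \<open>k \<ge> 1\<close>; their values at \<open>k = 0\<close> are irrelevant.\<close>

definition fourier_mode ::
    "real \<Rightarrow> (nat \<Rightarrow> real) \<Rightarrow> (nat \<Rightarrow> real) \<Rightarrow> (nat \<Rightarrow> 'a \<Rightarrow> real) \<Rightarrow> (nat \<Rightarrow> real \<Rightarrow> 'a \<Rightarrow> real) \<Rightarrow>
     real \<Rightarrow> nat \<Rightarrow> real \<Rightarrow> 'a \<Rightarrow> real" where
  "fourier_mode \<sigma> \<mu> q u0 w \<theta> k t \<omega> =
    u0 k \<omega> * exp (- (\<theta> * \<mu> k + 1 / 2 * \<sigma>\<^sup>2 * (q k)\<^sup>2) * t + \<sigma> * q k * w k t \<omega>)"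

definition fisher_info :: "real \<Rightarrow> real \<Rightarrow> (nat \<Rightarrow> real) \<Rightarrow> (nat \<Rightarrow> real) \<Rightarrow> nat \<Rightarrow> real" where
  "fisher_info T \<sigma> \<mu> q N = T / \<sigma>\<^sup>2 * (\<Sum>k=1..N. (\<mu> k)\<^sup>2 / (q k)\<^sup>2)"

text \<open>The estimators are functionals of the observed processes \<open>u\<close>.\<close>

definition theta_hat ::
    "'a measure \<Rightarrow> real \<Rightarrow> (nat \<Rightarrow> real) \<Rightarrow> (nat \<Rightarrow> real) \<Rightarrow> (nat \<Rightarrow> real \<Rightarrow> 'a \<Rightarrow> real) \<Rightarrow> nat \<Rightarrow> 'a \<Rightarrow> real" where
  "theta_hat M T \<mu> q u N \<omega> =
    - (\<Sum>k=1..N. \<mu> k / (q k)\<^sup>2 * ito_integral M T (\<lambda>t \<omega>. 1 / u k t \<omega>) (u k) \<omega>) /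
      (T * (\<Sum>k=1..N. (\<mu> k)\<^sup>2 / (q k)\<^sup>2))"

definition theta_mle ::
    "'a measure \<Rightarrow> real \<Rightarrow> (nat \<Rightarrow> real) \<Rightarrow> (nat \<Rightarrow> real) \<Rightarrow> (nat \<Rightarrow> real \<Rightarrow> 'a \<Rightarrow> real) \<Rightarrow> nat \<Rightarrow> 'a \<Rightarrow> real" where
  "theta_mle M T \<mu> q u N \<omega> =
    indicator {0<..} (theta_hat M T \<mu> q u N \<omega>) * theta_hat M T \<mu> q u N \<omega>"

definition xi_approx ::
    "real \<Rightarrow> real \<Rightarrow> (nat \<Rightarrow> real) \<Rightarrow> (nat \<Rightarrow> real) \<Rightarrow> (nat \<Rightarrow> real \<Rightarrow> 'a \<Rightarrow> real) \<Rightarrow> nat \<Rightarrow> 'a \<Rightarrow> real" where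
  "xi_approx T \<sigma> \<mu> q w N \<omega> =
    - (1 / (\<sigma> * sqrt (fisher_info T \<sigma> \<mu> q N))) * (\<Sum>k=1..N. \<mu> k / q k * w k T \<omega>)"

section \<open>Loss functions\<close>

definition loss_functions :: "(real \<Rightarrow> real) set" where
  "loss_functions = {l \<in> borel_measurable borel.
     (\<forall>x. 0 \<le> l x) \<and> (\<forall>x. l (- x) = l x) \<and> mono_on {0..} l \<and>
     l 0 = 0 \<and> isCont l 0 \<and> (\<exists>x. l x \<noteq> 0)}"

definition poly_loss_functions :: "(real \<Rightarrow> real) set" where
  "poly_loss_functions =
    {l \<in> loss_functions. \<exists>P :: real poly. \<forall>\<^sub>F x in at_infinity. l x \<le> poly P x}"

end

theory Submission
  imports Defs
begin

text \<open>
  Each mode \<open>u k\<close> is a geometric Brownian motion, and by Ito's formula \<open>du / u\<close> has the integral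
  \<open>\<sigma> * q k * w k T - \<theta> * \<mu> k * T\<close> over \<open>[0, T]\<close>, the increment of a Brownian motion with drift.
  Inserting this into the estimator shows that \<open>theta_hat = \<theta> + \<xi>\<^sub>N / sqrt (I N)\<close> almost surely, where
  \<open>\<xi>\<^sub>N\<close> is the normalised sum of the noises (\<open>theta_hat_eq\<close>). As the noises are independent and the
  Fisher information is their variance, \<open>\<xi>\<^sub>N\<close> is exactly standard normal (\<open>noise_std_normal\<close>): the
  raw estimator has an exactly Gaussian error for every \<open>N \<ge> 1\<close>. The well-posedness condition makes
  \<open>I N\<close> tend to infinity.

  The maximum likelihood estimator is the positive part of \<open>theta_hat\<close>. It is at least as close to the positive
  true parameter as \<open>theta_hat\<close>, and differs from it only if \<open>\<xi>\<^sub>N \<le> - \<theta> * sqrt (I N)\<close>, an event of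
  probability at most \<open>1 / (\<theta>\<^sup>2 * I N)\<close>. Consistency follows from Chebyshev's inequality, the
  approximation by \<open>\<xi>\<^sub>N\<close> and the asymptotic normality from the smallness of this event, uniformly on
  compact sets. For a loss function the risk is at most the Gaussian risk at every parameter, by
  monotonicity of the loss, and Fatou's lemma gives the reverse inequality in the limit; hence the
  local supremum has the Gaussian risk as its limit in every neighbourhood
  (\<open>nn_integral_loss_bounds\<close>, \<open>nn_integral_truncated_liminf\<close>).

  The stochastic integral is the limit in probability of Riemann sums, and for this
  integrand Ito's formula can be proved by hand (\<open>has_ito_integral_geometric_bm\<close>): the error made in
  one step is an explicit function of one Gaussian increment whose mean and mean square are of second
  order in the step size, and the errors of different steps are independent.
\<close>

section \<open>Exponential moments of a centred normal variable\<close>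

lemma has_bochner_integral_distributed:
  fixes g :: "real \<Rightarrow> real"
  assumes "distributed M lborel X f" "g \<in> borel_measurable borel" "\<And>x. 0 \<le> f x"
    and "has_bochner_integral lborel (\<lambda>x. f x * g x) c"
  shows "has_bochner_integral M (\<lambda>\<omega>. g (X \<omega>)) c"
  using distributed_integral[OF assms(1), of g] distributed_integrable[OF assms(1), of g] assms
  by (auto simp: has_bochner_integral_iff)

text \<open>Completing the square: weighting a centred normal density exponentially only shifts its mean.
  Mixed moments with an exponential factor thereby become ordinary moments of a shifted normal law.\<close>
lemma normal_density_exp_tilt:
  fixes s :: real
  assumes "s > 0"
  shows "normal_density 0 s x * exp (b * x) = exp (b\<^sup>2 * s\<^sup>2 / 2) * normal_density (b * s\<^sup>2) s x"
proof -
  have "- x\<^sup>2 / (2 * s\<^sup>2) + b * x = b\<^sup>2 * s\<^sup>2 / 2 + - (x - b * s\<^sup>2)\<^sup>2 / (2 * s\<^sup>2)"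
    using assms by (simp add: field_simps power2_eq_square)
  then have "exp (- x\<^sup>2 / (2 * s\<^sup>2)) * exp (b * x) =
      exp (b\<^sup>2 * s\<^sup>2 / 2) * exp (- (x - b * s\<^sup>2)\<^sup>2 / (2 * s\<^sup>2))"
    by (simp only: exp_add [symmetric])
  then show ?thesis
    by (simp add: normal_density_def)
qed

lemma normal_exponential_moments:
  fixes s :: real
  assumes D: "distributed M lborel Z (normal_density 0 s)" and s: "s > 0"
  shows "has_bochner_integral M (\<lambda>\<omega>. exp (b * Z \<omega>)) (exp (b\<^sup>2 * s\<^sup>2 / 2))"
    and "has_bochner_integral M (\<lambda>\<omega>. Z \<omega> * exp (b * Z \<omega>)) (exp (b\<^sup>2 * s\<^sup>2 / 2) * (b * s\<^sup>2))"
proof -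
  have "has_bochner_integral lborel (normal_density (b * s\<^sup>2) s) 1"
    using s by (simp add: has_bochner_integral_iff)
  from has_bochner_integral_mult_right[OF this, of "exp (b\<^sup>2 * s\<^sup>2 / 2)"]
  have "has_bochner_integral lborel (\<lambda>x. normal_density 0 s x * exp (b * x)) (exp (b\<^sup>2 * s\<^sup>2 / 2))"
    by (simp add: normal_density_exp_tilt[OF s])
  then show "has_bochner_integral M (\<lambda>\<omega>. exp (b * Z \<omega>)) (exp (b\<^sup>2 * s\<^sup>2 / 2))"
    by (rule has_bochner_integral_distributed[OF D, rotated 2]) auto
  have eq: "normal_density 0 s x * (x * exp (b * x)) =
      exp (b\<^sup>2 * s\<^sup>2 / 2) * (normal_density (b * s\<^sup>2) s x * x)" for x
    using normal_density_exp_tilt[OF s, of x b] by (simp add: algebra_simps)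
  from has_bochner_integral_mult_right[OF normal_moment_nz_1[OF s], of "exp (b\<^sup>2 * s\<^sup>2 / 2)" "b * s\<^sup>2"]
  have "has_bochner_integral lborel (\<lambda>x. normal_density 0 s x * (x * exp (b * x)))
      (exp (b\<^sup>2 * s\<^sup>2 / 2) * (b * s\<^sup>2))"
    by (simp add: eq)
  then show "has_bochner_integral M (\<lambda>\<omega>. Z \<omega> * exp (b * Z \<omega>)) (exp (b\<^sup>2 * s\<^sup>2 / 2) * (b * s\<^sup>2))"
    by (rule has_bochner_integral_distributed[OF D, rotated 2]) auto
qed

lemma normal_first_two_moments:
  fixes s :: real
  assumes D: "distributed M lborel Z (normal_density 0 s)" and s: "s > 0"
  shows "has_bochner_integral M Z 0" and "has_bochner_integral M (\<lambda>\<omega>. (Z \<omega>)\<^sup>2) (s\<^sup>2)"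
proof -
  show "has_bochner_integral M Z 0"
    using normal_moment_nz_1[OF s, of 0]
    by (rule has_bochner_integral_distributed[OF D, rotated 2, of "\<lambda>x. x"]) auto
  have "has_bochner_integral lborel (\<lambda>x. normal_density 0 s x * x\<^sup>2) (s\<^sup>2)"
    using normal_moment_even[OF s, of 0 1] s by (simp add: fact_numeral)
  then show "has_bochner_integral M (\<lambda>\<omega>. (Z \<omega>)\<^sup>2) (s\<^sup>2)"
    by (rule has_bochner_integral_distributed[OF D, rotated 2]) auto
qed

section \<open>Riemann sums of a geometric Brownian motion\<close>

text \<open>Over a time step \<open>h\<close> with Brownian increment \<open>Z\<close>, a geometric Brownian motion \<open>X\<close> with
  \<open>dX = - m X dt + b X dw\<close> is multiplied by \<open>exp (- (m + b\<^sup>2 / 2) * h + b * Z)\<close>, so \<open>d\<close> is the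
  difference between the relative increment of \<open>X\<close> and the increment of \<open>b w - m t\<close>. Both moments
  vanish to second order as \<open>h\<close> tends to 0: in the mean square the constant and linear terms cancel
  because \<open>b\<^sup>2 / 2\<close> is the Ito correction.\<close>
lemma (in prob_space) geometric_increment_error_moments:
  fixes b m h :: real
  assumes D: "distributed M lborel Z (normal_density 0 (sqrt h))" and h: "h > 0"
  defines "d \<equiv> \<lambda>\<omega>. exp (- (m + b\<^sup>2 / 2) * h + b * Z \<omega>) - 1 - (b * Z \<omega> - m * h)"
  shows "has_bochner_integral M d (exp (- m * h) - 1 + m * h)"
    and "has_bochner_integral M (\<lambda>\<omega>. (d \<omega>)\<^sup>2)
      (exp ((b\<^sup>2 - 2 * m) * h) + (1 - m * h)\<^sup>2 + b\<^sup>2 * h - 2 * (1 - m * h + b\<^sup>2 * h) * exp (- m * h))"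
proof -
  have s: "sqrt h > 0" and s2: "(sqrt h)\<^sup>2 = h" using h by auto
  define a where "a = exp (- (m + b\<^sup>2 / 2) * h)"
  note mom = normal_exponential_moments[OF D s, unfolded s2]
    normal_first_two_moments[OF D s, unfolded s2]
  have one: "has_bochner_integral M (\<lambda>\<omega>. c) c" for c :: real
    by (simp add: has_bochner_integral_iff prob_space)
  have d_eq: "d \<omega> = a * exp (b * Z \<omega>) - (1 - m * h) - b * Z \<omega>" for \<omega>
    by (simp only: d_def exp_add a_def)
  have a1: "a * exp (b\<^sup>2 * h / 2) = exp (- m * h)"
    by (simp add: a_def flip: exp_add) (simp add: algebra_simps)
  have a2: "a\<^sup>2 * exp ((2 * b)\<^sup>2 * h / 2) = exp ((b\<^sup>2 - 2 * m) * h)"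
    by (simp add: a_def power2_eq_square flip: exp_add) (simp add: algebra_simps)
  have "has_bochner_integral M (\<lambda>\<omega>. a * exp (b * Z \<omega>) - (1 - m * h) - b * Z \<omega>)
      (a * exp (b\<^sup>2 * h / 2) - (1 - m * h) - b * 0)"
    by (intro has_bochner_integral_diff has_bochner_integral_mult_right mom one)
  then show "has_bochner_integral M d (exp (- m * h) - 1 + m * h)"
    unfolding d_eq[abs_def] a1 by (simp add: algebra_simps)
  have "has_bochner_integral M
     (\<lambda>\<omega>. a\<^sup>2 * exp ((2 * b) * Z \<omega>) + (1 - m * h)\<^sup>2 + b\<^sup>2 * (Z \<omega>)\<^sup>2
        - 2 * (1 - m * h) * a * exp (b * Z \<omega>) + 2 * (1 - m * h) * b * Z \<omega>
        - 2 * b * a * (Z \<omega> * exp (b * Z \<omega>)))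
     (a\<^sup>2 * exp ((2 * b)\<^sup>2 * h / 2) + (1 - m * h)\<^sup>2 + b\<^sup>2 * h
        - 2 * (1 - m * h) * a * exp (b\<^sup>2 * h / 2) + 2 * (1 - m * h) * b * 0
        - 2 * b * a * (exp (b\<^sup>2 * h / 2) * (b * h)))"
    by (intro has_bochner_integral_diff has_bochner_integral_add has_bochner_integral_mult_right mom one)
  also have "(\<lambda>\<omega>. a\<^sup>2 * exp ((2 * b) * Z \<omega>) + (1 - m * h)\<^sup>2 + b\<^sup>2 * (Z \<omega>)\<^sup>2
        - 2 * (1 - m * h) * a * exp (b * Z \<omega>) + 2 * (1 - m * h) * b * Z \<omega>
        - 2 * b * a * (Z \<omega> * exp (b * Z \<omega>))) = (\<lambda>\<omega>. (d \<omega>)\<^sup>2)"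
  proof
    fix \<omega>
    have "exp ((2 * b) * Z \<omega>) = (exp (b * Z \<omega>))\<^sup>2"
      by (simp add: power2_eq_square flip: exp_add)
    then show "a\<^sup>2 * exp ((2 * b) * Z \<omega>) + (1 - m * h)\<^sup>2 + b\<^sup>2 * (Z \<omega>)\<^sup>2
        - 2 * (1 - m * h) * a * exp (b * Z \<omega>) + 2 * (1 - m * h) * b * Z \<omega>
        - 2 * b * a * (Z \<omega> * exp (b * Z \<omega>)) = (d \<omega>)\<^sup>2"
      unfolding d_eq by algebra
  qed
  also have "a\<^sup>2 * exp ((2 * b)\<^sup>2 * h / 2) + (1 - m * h)\<^sup>2 + b\<^sup>2 * h
        - 2 * (1 - m * h) * a * exp (b\<^sup>2 * h / 2) + 2 * (1 - m * h) * b * 0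
        - 2 * b * a * (exp (b\<^sup>2 * h / 2) * (b * h)) =
      exp ((b\<^sup>2 - 2 * m) * h) + (1 - m * h)\<^sup>2 + b\<^sup>2 * h - 2 * (1 - m * h + b\<^sup>2 * h) * exp (- m * h)"
    unfolding a2[symmetric] a1[symmetric] by algebra
  finally show "has_bochner_integral M (\<lambda>\<omega>. (d \<omega>)\<^sup>2)
      (exp ((b\<^sup>2 - 2 * m) * h) + (1 - m * h)\<^sup>2 + b\<^sup>2 * h - 2 * (1 - m * h + b\<^sup>2 * h) * exp (- m * h))" .
qed

lemma exp_second_order_bound:
  fixes x y K :: real
  assumes "\<bar>x\<bar> \<le> K"
  shows "\<bar>exp x - 1 - x\<bar> \<le> exp K * x\<^sup>2"
proof -
  obtain t where t: "\<bar>t\<bar> \<le> \<bar>x\<bar>" and e: "exp x = (\<Sum>i<2. x ^ i / fact i) + exp t / fact 2 * x\<^sup>2"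
    using Maclaurin_exp_le[of x 2] by blast
  have "exp x - 1 - x = exp t / 2 * x\<^sup>2"
    using e by (simp add: numeral_2_eq_2)
  moreover have "exp t \<le> exp K" using t assms by simp
  then have "exp t / 2 \<le> exp K" using exp_gt_zero[of t] by linarith
  then have "exp t / 2 * x\<^sup>2 \<le> exp K * x\<^sup>2" by (rule mult_right_mono) simp
  moreover have "0 \<le> exp t / 2 * x\<^sup>2" by simp
  ultimately show ?thesis by linarith
qed

text \<open>The two expressions are the mean and the mean square of the one-step error in
  \<open>geometric_increment_error_moments\<close>; replacing each exponential by its linear Taylor polynomial
  leaves only terms of order \<open>h\<^sup>2\<close>.\<close>
lemma increment_error_moments_quadratic:
  fixes m b T :: real
  obtains C where "C > 0"
    and "\<And>h. 0 \<le> h \<Longrightarrow> h \<le> T \<Longrightarrow> \<bar>exp (- m * h) - 1 + m * h\<bar> \<le> C * h\<^sup>2"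
    and "\<And>h. 0 \<le> h \<Longrightarrow> h \<le> T \<Longrightarrow> exp ((b\<^sup>2 - 2 * m) * h) + (1 - m * h)\<^sup>2 + b\<^sup>2 * h
            - 2 * (1 - m * h + b\<^sup>2 * h) * exp (- m * h) \<le> C * h\<^sup>2"
proof -
  define v where "v = b\<^sup>2 - 2 * m"
  define C1 where "C1 = exp (\<bar>m\<bar> * T) * m\<^sup>2"
  define C2 where "C2 = exp (\<bar>v\<bar> * T) * v\<^sup>2"
  define L where "L = 1 + \<bar>b\<^sup>2 - m\<bar> * T"
  define C where "C = C1 + C2 + 2 * L * C1 + 2 * \<bar>m\<bar> * b\<^sup>2 + m\<^sup>2 + 1"
  have taylor: "\<bar>exp (c * h) - 1 - c * h\<bar> \<le> exp (\<bar>c\<bar> * T) * c\<^sup>2 * h\<^sup>2" if "0 \<le> h" "h \<le> T" for c h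
    using exp_second_order_bound[of "c * h" "\<bar>c\<bar> * T"] that
    by (simp add: abs_mult mult_left_mono power_mult_distrib mult.assoc)
  show ?thesis
  proof (cases "T \<ge> 0")
    case True
    have pos: "C1 \<ge> 0" "C2 \<ge> 0" "L \<ge> 0" using True by (auto simp: C1_def C2_def L_def)
    have LC: "2 * L * C1 \<ge> 0" "2 * \<bar>m\<bar> * b\<^sup>2 \<ge> 0" "m\<^sup>2 \<ge> 0" using pos by auto
    have Cpos: "C > 0" using pos LC unfolding C_def by linarith
    have C1C: "C1 \<le> C" using pos LC unfolding C_def by linarith
    show ?thesis
    proof
      show "C > 0" by fact
      fix h assume h: "0 \<le> h" "h \<le> T"
      define r1 where "r1 = exp (- m * h) - 1 + m * h"
      define r2 where "r2 = exp (v * h) - 1 - v * h"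
      have r1: "\<bar>r1\<bar> \<le> C1 * h\<^sup>2" using taylor[OF h, of "- m"] by (simp add: r1_def C1_def)
      have r2: "\<bar>r2\<bar> \<le> C2 * h\<^sup>2" using taylor[OF h, of v] by (simp add: r2_def C2_def)
      show "\<bar>exp (- m * h) - 1 + m * h\<bar> \<le> C * h\<^sup>2"
        using r1 C1C unfolding r1_def by (rule order_trans[OF _ mult_right_mono]) simp
      have "\<bar>1 - m * h + b\<^sup>2 * h\<bar> \<le> 1 + \<bar>(b\<^sup>2 - m) * h\<bar>"
        by (simp add: algebra_simps)
      also have "\<dots> \<le> L" using h unfolding L_def by (simp add: abs_mult mult_left_mono)
      finally have Lb: "\<bar>1 - m * h + b\<^sup>2 * h\<bar> \<le> L" .
      have t1: "- ((1 - m * h + b\<^sup>2 * h) * r1) \<le> L * (C1 * h\<^sup>2)"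
        using mult_mono[OF Lb r1] pos by (simp add: abs_mult[symmetric])
      have t2: "m * b\<^sup>2 * h\<^sup>2 \<le> \<bar>m\<bar> * b\<^sup>2 * h\<^sup>2" by (intro mult_right_mono) auto
      have "exp (v * h) + (1 - m * h)\<^sup>2 + b\<^sup>2 * h - 2 * (1 - m * h + b\<^sup>2 * h) * exp (- m * h)
         = (r2 + 1 + v * h) + (1 - m * h)\<^sup>2 + b\<^sup>2 * h - 2 * (1 - m * h + b\<^sup>2 * h) * (r1 + 1 - m * h)"
        by (simp add: r1_def r2_def)
      also have "\<dots> = r2 - 2 * ((1 - m * h + b\<^sup>2 * h) * r1) + 2 * (m * b\<^sup>2 * h\<^sup>2) - m\<^sup>2 * h\<^sup>2"
        unfolding v_def by algebra
      also have "\<dots> \<le> C2 * h\<^sup>2 + 2 * (L * (C1 * h\<^sup>2)) + 2 * (\<bar>m\<bar> * b\<^sup>2 * h\<^sup>2)"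
        using abs_ge_self[of r2] r2 t1 t2 zero_le_power2[of "m * h"]
        unfolding power_mult_distrib by linarith
      also have "\<dots> = (C2 + 2 * L * C1 + 2 * \<bar>m\<bar> * b\<^sup>2) * h\<^sup>2"
        by (simp add: algebra_simps)
      also have "\<dots> \<le> C * h\<^sup>2"
        using pos zero_le_power2[of m] by (intro mult_right_mono) (auto simp: C_def)
      finally show "exp ((b\<^sup>2 - 2 * m) * h) + (1 - m * h)\<^sup>2 + b\<^sup>2 * h
            - 2 * (1 - m * h + b\<^sup>2 * h) * exp (- m * h) \<le> C * h\<^sup>2"
        by (simp add: v_def)
    qed
  qed (rule that[of 1], auto)
qed

text \<open>If mean and mean square of every term are at most \<open>r i\<close>, the cross term added at step \<open>i\<close>
  factorises by independence and is at most twice \<open>r i\<close> times the sum of the earlier bounds: exactly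
  what squaring the sum of the bounds adds, up to \<open>(r i)\<^sup>2\<close>.\<close>
lemma (in prob_space) second_moment_indep_partial_sums:
  fixes X :: "nat \<Rightarrow> 'a \<Rightarrow> real" and r :: "nat \<Rightarrow> real"
  assumes "\<And>i. i < n \<Longrightarrow> integrable M (X i)"
    and "\<And>i. i < n \<Longrightarrow> integrable M (\<lambda>\<omega>. (X i \<omega>)\<^sup>2)"
    and "\<And>i. i < n \<Longrightarrow> \<bar>expectation (X i)\<bar> \<le> r i"
    and "\<And>i. i < n \<Longrightarrow> expectation (\<lambda>\<omega>. (X i \<omega>)\<^sup>2) \<le> r i"
    and "\<And>i. i < n \<Longrightarrow> indep_var borel (\<lambda>\<omega>. \<Sum>j<i. X j \<omega>) borel (X i)"
  shows "integrable M (\<lambda>\<omega>. (\<Sum>i<n. X i \<omega>)\<^sup>2)"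
    and "expectation (\<lambda>\<omega>. (\<Sum>i<n. X i \<omega>)\<^sup>2) \<le> (\<Sum>i<n. r i) + (\<Sum>i<n. r i)\<^sup>2"
proof -
  have "integrable M (\<lambda>\<omega>. \<Sum>i<k. X i \<omega>) \<and> \<bar>expectation (\<lambda>\<omega>. \<Sum>i<k. X i \<omega>)\<bar> \<le> (\<Sum>i<k. r i) \<and>
      integrable M (\<lambda>\<omega>. (\<Sum>i<k. X i \<omega>)\<^sup>2) \<and>
      expectation (\<lambda>\<omega>. (\<Sum>i<k. X i \<omega>)\<^sup>2) \<le> (\<Sum>i<k. r i) + (\<Sum>i<k. r i)\<^sup>2" if "k \<le> n" for k
    using that
  proof (induction k)
    case (Suc k)
    let ?S = "\<lambda>\<omega>. \<Sum>i<k. X i \<omega>" and ?R = "\<Sum>i<k. r i"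
    have kn: "k < n" using Suc.prems by simp
    note IH = Suc.IH[OF less_imp_le[OF kn]]
    note Xk = assms(1-4)[OF kn]
    have rk: "r k \<ge> 0" using Xk(3) by linarith
    have ind: "indep_var borel ?S borel (X k)" by (rule assms(5)[OF kn])
    have cross: "integrable M (\<lambda>\<omega>. ?S \<omega> * X k \<omega>)"
      "expectation (\<lambda>\<omega>. ?S \<omega> * X k \<omega>) = expectation ?S * expectation (X k)"
      using indep_var_integrable[OF ind] indep_var_lebesgue_integral[OF ind] IH Xk(1) by auto
    have sq: "(\<Sum>i<Suc k. X i \<omega>)\<^sup>2 = (?S \<omega>)\<^sup>2 + 2 * (?S \<omega> * X k \<omega>) + (X k \<omega>)\<^sup>2" for \<omega>
      by (simp add: power2_sum)
    have "\<bar>expectation ?S * expectation (X k)\<bar> \<le> ?R * r k"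
      unfolding abs_mult using IH Xk(3) by (intro mult_mono) auto
    then have prod: "expectation ?S * expectation (X k) \<le> ?R * r k" by linarith
    have "expectation (\<lambda>\<omega>. (\<Sum>i<Suc k. X i \<omega>)\<^sup>2) =
       expectation (\<lambda>\<omega>. (?S \<omega>)\<^sup>2) + 2 * (expectation ?S * expectation (X k)) + expectation (\<lambda>\<omega>. (X k \<omega>)\<^sup>2)"
      unfolding sq using IH Xk cross by simp
    also have "\<dots> \<le> (?R + ?R\<^sup>2) + 2 * (?R * r k) + r k"
      using IH prod Xk(4) by (intro add_mono) auto
    also have "\<dots> \<le> (\<Sum>i<Suc k. r i) + (\<Sum>i<Suc k. r i)\<^sup>2"
      using rk by (simp add: power2_sum)
    finally have "expectation (\<lambda>\<omega>. (\<Sum>i<Suc k. X i \<omega>)\<^sup>2) \<le> (\<Sum>i<Suc k. r i) + (\<Sum>i<Suc k. r i)\<^sup>2" .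
    moreover have "integrable M (\<lambda>\<omega>. (\<Sum>i<Suc k. X i \<omega>)\<^sup>2)"
      unfolding sq using IH Xk cross by simp
    moreover have "integrable M (\<lambda>\<omega>. \<Sum>i<Suc k. X i \<omega>)" using IH Xk by simp
    moreover have "\<bar>expectation (\<lambda>\<omega>. \<Sum>i<Suc k. X i \<omega>)\<bar> \<le> (\<Sum>i<Suc k. r i)"
      using IH Xk abs_triangle_ineq[of "expectation ?S" "expectation (X k)"] by simp
    ultimately show ?case by blast
  qed simp
  from this[OF order_refl]
  show "integrable M (\<lambda>\<omega>. (\<Sum>i<n. X i \<omega>)\<^sup>2)"
    and "expectation (\<lambda>\<omega>. (\<Sum>i<n. X i \<omega>)\<^sup>2) \<le> (\<Sum>i<n. r i) + (\<Sum>i<n. r i)\<^sup>2"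
    by blast+
qed

lemma (in stochastic_basis) brownian_motionD:
  assumes "brownian_motion w" "0 \<le> t"
  shows "w t \<in> borel_measurable (F t)" "w t \<in> borel_measurable M"
    and "AE \<omega> in M. w 0 \<omega> = 0"
    and "0 \<le> s \<Longrightarrow> s < t \<Longrightarrow>
      distributed M lborel (\<lambda>\<omega>. w t \<omega> - w s \<omega>) (normal_density 0 (sqrt (t - s)))"
    and "0 \<le> s \<Longrightarrow> s < t \<Longrightarrow>
      indep_set (sets (F s)) {(\<lambda>\<omega>. w t \<omega> - w s \<omega>) -` A \<inter> space M | A. A \<in> sets borel}"
  using assms measurable_from_subalg[OF subalgebra_F, of t "w t" borel]
  unfolding brownian_motion_def by blast+

lemma (in stochastic_basis) adapted_mono:
  assumes "0 \<le> s" "s \<le> t" "Y \<in> borel_measurable (F s)"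
  shows "Y \<in> borel_measurable (F t)"
proof (rule measurable_from_subalg)
  show "subalgebra (F t) (F s)"
    using subalgebra_F[of s] subalgebra_F[of t] mono_F[of s t] assms by (auto simp: subalgebra_def)
qed (rule assms)

text \<open>The independence clause in the definition of Brownian motion speaks of a \<open>\<sigma>\<close>-algebra; this is
  its form for random variables, in which products of expectations can be factorised.\<close>
lemma (in stochastic_basis) brownian_increment_indep_var:
  assumes w: "brownian_motion w" and st: "0 \<le> s" "s < t" and Y: "Y \<in> borel_measurable (F s)"
  shows "indep_var borel Y borel (\<lambda>\<omega>. w t \<omega> - w s \<omega>)"
proof -
  let ?Z = "\<lambda>\<omega>. w t \<omega> - w s \<omega>"
  have t: "0 \<le> t" using st by simp
  have [measurable]: "w t \<in> borel_measurable M" "w s \<in> borel_measurable M"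
    using brownian_motionD(2)[OF w] st by auto
  have space: "space (F s) = space M" and sub: "sets (F s) \<subseteq> events"
    using subalgebra_F[OF st(1)] by (auto simp: subalgebra_def)
  have gen: "sigma_sets (space M) {f -` A \<inter> space M | A. A \<in> sets borel} =
      {f -` A \<inter> space M | A. A \<in> sets borel}" for f :: "'a \<Rightarrow> real"
    using sets_vimage_algebra[of "space M" f borel] sets_vimage_algebra2[of f "space M" borel] by simp
  have "{Y -` A \<inter> space M | A. A \<in> sets borel} \<subseteq> sets (F s)"
    using measurable_sets[OF Y] space by auto
  then have "indep_set {Y -` A \<inter> space M | A. A \<in> sets borel} {?Z -` A \<inter> space M | A. A \<in> sets borel}"
    using brownian_motionD(5)[OF w t st] unfolding indep_set_def
    by (elim indep_sets_mono_sets) (auto split: bool.split)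
  moreover have "random_variable borel Y"
    using measurable_from_subalg[OF subalgebra_F[OF st(1)] Y] .
  ultimately show ?thesis
    unfolding indep_var_eq gen by simp
qed

lemma partition_points_mono:
  assumes "partition_points T n p" "i \<le> j" "j \<le> n"
  shows "p i \<le> p j"
  using assms(2,3)
proof (induction j rule: dec_induct)
  case (step k)
  then have "p k < p (Suc k)" using assms(1) by (simp add: partition_points_def)
  with step show ?case by simp
qed simp

lemma partition_points_range:
  assumes "partition_points T n p" "i \<le> n"
  shows "0 \<le> p i" "p i \<le> T"
  using partition_points_mono[OF assms(1), of 0 i] partition_points_mono[OF assms(1), of i n] assms
  by (auto simp: partition_points_def)

text \<open>The vanishing of this sum with the mesh turns one-step errors of second order into a
  negligible total error.\<close>
lemma partition_points_sum_squares:
  assumes p: "partition_points T n p" and mesh: "\<And>i. i < n \<Longrightarrow> p (Suc i) - p i < \<delta>"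
  shows "(\<Sum>i<n. (p (Suc i) - p i)\<^sup>2) \<le> \<delta> * T"
proof -
  have "(\<Sum>i<n. (p (Suc i) - p i)\<^sup>2) \<le> (\<Sum>i<n. \<delta> * (p (Suc i) - p i))"
  proof (rule sum_mono)
    fix i assume "i \<in> {..<n}"
    then have "p (Suc i) - p i < \<delta>" "0 < p (Suc i) - p i"
      using mesh p by (auto simp: partition_points_def)
    then show "(p (Suc i) - p i)\<^sup>2 \<le> \<delta> * (p (Suc i) - p i)"
      unfolding power2_eq_square by (intro mult_right_mono) auto
  qed
  also have "\<dots> = \<delta> * T"
    using p by (simp add: sum_distrib_left[symmetric] sum_lessThan_telescope partition_points_def)
  finally show ?thesis .
qed

text \<open>The solution of \<open>dX = - m X dt + b X dw\<close> started at \<open>X0\<close>.\<close>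
definition geometric_bm :: "real \<Rightarrow> real \<Rightarrow> ('a \<Rightarrow> real) \<Rightarrow> (real \<Rightarrow> 'a \<Rightarrow> real) \<Rightarrow> real \<Rightarrow> 'a \<Rightarrow> real" where
  "geometric_bm m b X0 w t \<omega> = X0 \<omega> * exp (- (m + b\<^sup>2 / 2) * t + b * w t \<omega>)"

text \<open>The Riemann sum of \<open>dX / X\<close> differs from \<open>b (w T - w 0) - m T\<close> by the sum of the one-step
  errors \<open>d i\<close>. Each depends only on its own Brownian increment, hence is independent of the sum of
  its predecessors, and has mean and mean square of order \<open>h i ^ 2\<close>. So the total error has second
  moment of the order of the mesh, and Chebyshev's inequality gives convergence in probability.
  The initial value cancels in all quotients, outside the null set on which it is zero.\<close>
lemma (in stochastic_basis) has_ito_integral_geometric_bm: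
  assumes w: "brownian_motion w" and T: "T > 0"
    and X0: "X0 \<in> borel_measurable M" "AE \<omega> in M. X0 \<omega> \<noteq> 0"
  shows "has_ito_integral M T (\<lambda>t \<omega>. 1 / geometric_bm m b X0 w t \<omega>) (geometric_bm m b X0 w)
    (\<lambda>\<omega>. b * (w T \<omega> - w 0 \<omega>) - m * T)"
  unfolding has_ito_integral_def
proof (intro conjI ballI allI impI)
  let ?X = "geometric_bm m b X0 w"
  have wM [measurable]: "w t \<in> borel_measurable M" if "t \<in> {0..T}" for t
    using brownian_motionD(2)[OF w, of t] that by simp
  have XM: "?X t \<in> borel_measurable M" if "t \<in> {0..T}" for t
    unfolding geometric_bm_def[abs_def] using wM[OF that] X0(1) by measurable
  fix t assume t: "t \<in> {0..T}"
  show "?X t \<in> borel_measurable M" by (rule XM[OF t])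
  then show "(\<lambda>\<omega>. 1 / ?X t \<omega>) \<in> borel_measurable M" by measurable
next
  have [measurable]: "w T \<in> borel_measurable M" "w 0 \<in> borel_measurable M"
    using brownian_motionD(2)[OF w] T by auto
  show "(\<lambda>\<omega>. b * (w T \<omega> - w 0 \<omega>) - m * T) \<in> borel_measurable M" by measurable
next
  let ?X = "geometric_bm m b X0 w"
  fix \<epsilon> \<eta> :: real assume \<epsilon>: "\<epsilon> > 0" and \<eta>: "\<eta> > 0"
  obtain C where C: "C > 0"
    "\<And>h. 0 \<le> h \<Longrightarrow> h \<le> T \<Longrightarrow> \<bar>exp (- m * h) - 1 + m * h\<bar> \<le> C * h\<^sup>2"
    "\<And>h. 0 \<le> h \<Longrightarrow> h \<le> T \<Longrightarrow> exp ((b\<^sup>2 - 2 * m) * h) + (1 - m * h)\<^sup>2 + b\<^sup>2 * h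
            - 2 * (1 - m * h + b\<^sup>2 * h) * exp (- m * h) \<le> C * h\<^sup>2"
    using increment_error_moments_quadratic[of T m b] by blast
  \<comment> \<open>The second moment of the total error will be at most \<open>\<rho> + \<rho>\<^sup>2 \<le> 2 * \<rho> < \<epsilon>\<^sup>2 * \<eta>\<close>; the mesh bound \<open>\<delta>\<close>
    makes \<open>\<rho>\<close> the bound on the sum of the \<open>C * (h i)\<^sup>2\<close>.\<close>
  define \<rho> where "\<rho> = min 1 (\<epsilon>\<^sup>2 * \<eta> / 3)"
  have \<rho>: "0 < \<rho>" "\<rho> \<le> 1" "\<rho> \<le> \<epsilon>\<^sup>2 * \<eta> / 3" using \<epsilon> \<eta> by (auto simp: \<rho>_def)
  define \<delta> where "\<delta> = \<rho> / (C * T)"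
  have \<delta>: "\<delta> > 0" using \<rho> C(1) T by (simp add: \<delta>_def)
  show "\<exists>\<delta>>0. \<forall>n p. partition_points T n p \<and> (\<forall>i<n. p (Suc i) - p i < \<delta>) \<longrightarrow>
      prob {\<omega> \<in> space M. \<epsilon> < \<bar>(\<Sum>i<n. 1 / ?X (p i) \<omega> * (?X (p (Suc i)) \<omega> - ?X (p i) \<omega>))
        - (b * (w T \<omega> - w 0 \<omega>) - m * T)\<bar>} < \<eta>"
  proof (intro exI[of _ \<delta>] conjI allI impI \<delta>)
    fix n p assume "partition_points T n p \<and> (\<forall>i<n. p (Suc i) - p i < \<delta>)"
    then have p: "partition_points T n p" and mesh: "\<And>i. i < n \<Longrightarrow> p (Suc i) - p i < \<delta>" by auto
    define h where "h i = p (Suc i) - p i" for i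
    define Z where "Z i \<omega> = w (p (Suc i)) \<omega> - w (p i) \<omega>" for i \<omega>
    define d where "d i \<omega> = exp (- (m + b\<^sup>2 / 2) * h i + b * Z i \<omega>) - 1 - (b * Z i \<omega> - m * h i)" for i \<omega>
    have rng: "0 \<le> p i" "p i \<le> T" if "i \<le> n" for i
      using partition_points_range[OF p that] .
    have h: "0 < h i" "h i \<le> T" "p i < p (Suc i)" if "i < n" for i
      using p that rng[of i] rng[of "Suc i"] by (auto simp: h_def partition_points_def)
    have D: "distributed M lborel (Z i) (normal_density 0 (sqrt (h i)))" if "i < n" for i
      unfolding Z_def h_def using brownian_motionD(4)[OF w] rng[of i] rng[of "Suc i"] h(3) that by simp
    note hbi = geometric_increment_error_moments[OF D h(1), where m = m and b = b, folded d_def]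
    have adapted: "d j \<in> borel_measurable (F (p i))" if "j < i" "i < n" for i j
    proof -
      have "w (p k) \<in> borel_measurable (F (p i))" if "k \<le> i" for k
      proof -
        have k: "0 \<le> p k" using rng(1)[of k] that \<open>i < n\<close> by simp
        have "p k \<le> p i" using partition_points_mono[OF p that] \<open>i < n\<close> by simp
        then show ?thesis by (rule adapted_mono[OF k _ brownian_motionD(1)[OF w k]])
      qed
      from this[of j] this[of "Suc j"] that(1)
      have "w (p j) \<in> borel_measurable (F (p i))" "w (p (Suc j)) \<in> borel_measurable (F (p i))" by auto
      then show ?thesis unfolding d_def[abs_def] Z_def by measurable
    qed
    have ind: "indep_var borel (\<lambda>\<omega>. \<Sum>j<i. d j \<omega>) borel (d i)" if i: "i < n" for i
    proof -
      have "(\<lambda>\<omega>. \<Sum>j<i. d j \<omega>) \<in> borel_measurable (F (p i))"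
        using adapted i by (intro borel_measurable_sum) auto
      then have "indep_var borel (\<lambda>\<omega>. \<Sum>j<i. d j \<omega>) borel (Z i)"
        unfolding Z_def using brownian_increment_indep_var[OF w] rng[of i] h(3)[OF i] i by simp
      then have "indep_var borel ((\<lambda>x. x) \<circ> (\<lambda>\<omega>. \<Sum>j<i. d j \<omega>)) borel
        ((\<lambda>z. exp (- (m + b\<^sup>2 / 2) * h i + b * z) - 1 - (b * z - m * h i)) \<circ> Z i)"
        by (rule indep_var_compose) measurable
      then show ?thesis by (simp add: comp_def d_def[abs_def])
    qed
    define R where "R = (\<Sum>i<n. C * (h i)\<^sup>2)"
    have moment: "integrable M (\<lambda>\<omega>. (\<Sum>i<n. d i \<omega>)\<^sup>2)" "expectation (\<lambda>\<omega>. (\<Sum>i<n. d i \<omega>)\<^sup>2) \<le> R + R\<^sup>2"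
    proof -
      have "integrable M (d i)" "integrable M (\<lambda>\<omega>. (d i \<omega>)\<^sup>2)"
         "\<bar>expectation (d i)\<bar> \<le> C * (h i)\<^sup>2" "expectation (\<lambda>\<omega>. (d i \<omega>)\<^sup>2) \<le> C * (h i)\<^sup>2" if i: "i < n" for i
        using hbi[OF i i] C(2,3)[of "h i"] h[OF i] by (auto simp: has_bochner_integral_iff)
      from second_moment_indep_partial_sums[OF this ind]
      show "integrable M (\<lambda>\<omega>. (\<Sum>i<n. d i \<omega>)\<^sup>2)" "expectation (\<lambda>\<omega>. (\<Sum>i<n. d i \<omega>)\<^sup>2) \<le> R + R\<^sup>2"
        unfolding R_def by auto
    qed
    have "R = C * (\<Sum>i<n. (p (Suc i) - p i)\<^sup>2)"
      by (simp add: R_def h_def sum_distrib_left)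
    also have "\<dots> \<le> C * (\<delta> * T)"
      using C(1) by (intro mult_left_mono partition_points_sum_squares[OF p mesh]) auto
    also have "\<dots> = \<rho>" using C(1) T by (simp add: \<delta>_def)
    finally have R: "R \<le> \<rho>" .
    have R0: "0 \<le> R" unfolding R_def using C(1) by (intro sum_nonneg) auto
    have "R\<^sup>2 \<le> R" using R R0 \<rho> by (simp add: power2_eq_square mult_left_le)
    then have second: "expectation (\<lambda>\<omega>. (\<Sum>i<n. d i \<omega>)\<^sup>2) < \<epsilon>\<^sup>2 * \<eta>"
      using moment(2) R \<rho> by linarith
    have dM: "(\<lambda>\<omega>. \<Sum>i<n. d i \<omega>) \<in> borel_measurable M"
      using hbi by (intro borel_measurable_sum) (auto dest: borel_measurable_has_bochner_integral)
    have eq: "(\<Sum>i<n. 1 / ?X (p i) \<omega> * (?X (p (Suc i)) \<omega> - ?X (p i) \<omega>)) - (b * (w T \<omega> - w 0 \<omega>) - m * T)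
       = (\<Sum>i<n. d i \<omega>)" if nz: "X0 \<omega> \<noteq> 0" for \<omega>
    proof -
      have ratio: "1 / ?X (p i) \<omega> * (?X (p (Suc i)) \<omega> - ?X (p i) \<omega>) = d i \<omega> + (b * Z i \<omega> - m * h i)" for i
      proof -
        let ?G = "exp (- (m + b\<^sup>2 / 2) * h i + b * Z i \<omega>)"
        have "- (m + b\<^sup>2 / 2) * p (Suc i) + b * w (p (Suc i)) \<omega> =
          (- (m + b\<^sup>2 / 2) * p i + b * w (p i) \<omega>) + (- (m + b\<^sup>2 / 2) * h i + b * Z i \<omega>)"
          unfolding h_def Z_def by algebra
        then have "?X (p (Suc i)) \<omega> = ?X (p i) \<omega> * ?G"
          by (simp only: geometric_bm_def exp_add mult.assoc)
        moreover have "?X (p i) \<omega> \<noteq> 0" using nz by (simp add: geometric_bm_def)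
        ultimately have "1 / ?X (p i) \<omega> * (?X (p (Suc i)) \<omega> - ?X (p i) \<omega>) = ?G - 1"
          by (simp add: right_diff_distrib)
        then show ?thesis by (simp add: d_def)
      qed
      have "(\<Sum>i<n. b * Z i \<omega> - m * h i) = b * (w T \<omega> - w 0 \<omega>) - m * T"
        using p sum_lessThan_telescope[of "\<lambda>i. w (p i) \<omega>" n] sum_lessThan_telescope[of p n]
        by (simp add: sum_subtractf sum_distrib_left[symmetric] Z_def h_def partition_points_def)
      then show ?thesis unfolding ratio sum.distrib by simp
    qed
    have pM: "?X (p i) \<in> borel_measurable M" if "i \<le> n" for i
      unfolding geometric_bm_def[abs_def] using brownian_motionD(2)[OF w rng(1)[OF that]] X0(1) by measurable
    have "prob {\<omega> \<in> space M. \<epsilon> < \<bar>(\<Sum>i<n. 1 / ?X (p i) \<omega> * (?X (p (Suc i)) \<omega> - ?X (p i) \<omega>))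
        - (b * (w T \<omega> - w 0 \<omega>) - m * T)\<bar>} \<le> prob {\<omega> \<in> space M. \<epsilon> \<le> \<bar>\<Sum>i<n. d i \<omega>\<bar>}"
    proof (rule finite_measure_mono_AE)
      show "AE \<omega> in M. \<omega> \<in> {\<omega> \<in> space M. \<epsilon> < \<bar>(\<Sum>i<n. 1 / ?X (p i) \<omega> * (?X (p (Suc i)) \<omega> - ?X (p i) \<omega>))
          - (b * (w T \<omega> - w 0 \<omega>) - m * T)\<bar>} \<longrightarrow> \<omega> \<in> {\<omega> \<in> space M. \<epsilon> \<le> \<bar>\<Sum>i<n. d i \<omega>\<bar>}"
        using X0(2)
      proof eventually_elim
        case (elim \<omega>)
        then show ?case unfolding mem_Collect_eq eq[OF elim] by simp
      qed
      show "{\<omega> \<in> space M. \<epsilon> \<le> \<bar>\<Sum>i<n. d i \<omega>\<bar>} \<in> events" using dM by measurable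
    qed
    also have "\<dots> \<le> expectation (\<lambda>\<omega>. (\<Sum>i<n. d i \<omega>)\<^sup>2) / \<epsilon>\<^sup>2"
      by (rule second_moment_method[OF dM moment(1) \<epsilon>])
    also have "\<dots> < \<eta>" using second \<epsilon> by (simp add: field_simps)
    finally show "prob {\<omega> \<in> space M. \<epsilon> < \<bar>(\<Sum>i<n. 1 / ?X (p i) \<omega> * (?X (p (Suc i)) \<omega> - ?X (p i) \<omega>))
        - (b * (w T \<omega> - w 0 \<omega>) - m * T)\<bar>} < \<eta>" .
  qed
qed

lemma (in stochastic_basis) ito_integral_geometric_bm:
  fixes m b :: real
  assumes w: "brownian_motion w" and T: "T > 0"
    and X0: "X0 \<in> borel_measurable M" "AE \<omega> in M. X0 \<omega> \<noteq> 0"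
  defines "J \<equiv> ito_integral M T (\<lambda>t \<omega>. 1 / geometric_bm m b X0 w t \<omega>) (geometric_bm m b X0 w)"
  shows "J \<in> borel_measurable M" and "AE \<omega> in M. J \<omega> = b * (w T \<omega> - w 0 \<omega>) - m * T"
proof -
  note has = has_ito_integral_geometric_bm[OF w T X0, of m b]
  have J: "has_ito_integral M T (\<lambda>t \<omega>. 1 / geometric_bm m b X0 w t \<omega>) (geometric_bm m b X0 w) J"
    unfolding J_def ito_integral_def
    using someI[of "has_ito_integral M T (\<lambda>t \<omega>. 1 / geometric_bm m b X0 w t \<omega>) (geometric_bm m b X0 w)", OF has] .
  show "J \<in> borel_measurable M" by (rule has_ito_integralD(1)[OF J])
  show "AE \<omega> in M. J \<omega> = b * (w T \<omega> - w 0 \<omega>) - m * T"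
    using has_ito_integral_unique[OF _ T J has] prob_space_axioms by blast
qed

section \<open>Truncation of a Gaussian location estimate\<close>

lemma distributed_nn_integral_eq:
  assumes "distributed M N X f" "distributed M' N Y f" "g \<in> borel_measurable N"
  shows "(\<integral>\<^sup>+ \<omega>. g (X \<omega>) \<partial>M) = (\<integral>\<^sup>+ \<omega>. g (Y \<omega>) \<partial>M')"
  using distributed_nn_integral[OF assms(1,3)] distributed_nn_integral[OF assms(2,3)] by simp

lemma distributed_integral_eq:
  fixes g :: "real \<Rightarrow> real"
  assumes "distributed M lborel X (\<lambda>x. ennreal (f x))" "distributed M' lborel Y (\<lambda>x. ennreal (f x))"
    and "g \<in> borel_measurable borel" "\<And>x. 0 \<le> f x"
  shows "(\<integral>\<omega>. g (X \<omega>) \<partial>M) = (\<integral>\<omega>. g (Y \<omega>) \<partial>M')"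
  using distributed_integral[OF assms(1), of g] distributed_integral[OF assms(2), of g] assms(3,4)
  by simp

lemma (in prob_space) std_normal_tail:
  assumes Z: "distributed M lborel Z std_normal_density" and t: "t > 0"
  shows "prob {\<omega>\<in>space M. t \<le> \<bar>Z \<omega>\<bar>} \<le> 1 / t\<^sup>2"
proof -
  have "has_bochner_integral M (\<lambda>\<omega>. (Z \<omega>)\<^sup>2) (1\<^sup>2)"
    by (rule normal_first_two_moments(2)) (use Z in auto)
  then have "integrable M (\<lambda>\<omega>. (Z \<omega>)\<^sup>2)" "expectation (\<lambda>\<omega>. (Z \<omega>)\<^sup>2) = 1"
    by (auto simp: has_bochner_integral_iff)
  moreover have "Z \<in> borel_measurable M" using distributed_measurable[OF Z] by simp
  ultimately show ?thesis using second_moment_method[of Z t] t by simp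
qed

text \<open>The estimation problem after the reduction: the raw estimator \<open>H\<close> equals the parameter plus
  a standard normal error \<open>Z\<close> divided by the rate \<open>a\<close>, and \<open>H\<close> is replaced by its positive part.
  Everything is bounded explicitly in \<open>a\<close> and \<open>\<theta>\<close>, so that uniformity in \<open>\<theta>\<close> can be read off.\<close>
locale gaussian_location_estimate = prob_space M for M :: "'a measure" +
  fixes H Z :: "'a \<Rightarrow> real" and a \<theta> :: real
  assumes H_measurable [measurable]: "H \<in> borel_measurable M"
    and Z_normal: "distributed M lborel Z std_normal_density"
    and a_pos: "a > 0" and theta_pos: "\<theta> > 0"
    and H_eq: "AE \<omega> in M. H \<omega> = \<theta> + Z \<omega> / a"
begin

lemma Z_measurable [measurable]: "Z \<in> borel_measurable M"
  using distributed_measurable[OF Z_normal] by simp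

text \<open>As the true parameter is positive, replacing \<open>H\<close> by its positive part never moves it away
  from the parameter; and nothing changes unless \<open>H\<close> is nonpositive, that is, \<open>Z\<close> is at most \<open>- (\<theta> * a)\<close>.\<close>
lemma scaled_error_cases:
  "AE \<omega> in M. \<bar>a * (max 0 (H \<omega>) - \<theta>)\<bar> \<le> \<bar>Z \<omega>\<bar> \<and>
     (- (\<theta> * a) < Z \<omega> \<longrightarrow> a * (max 0 (H \<omega>) - \<theta>) = Z \<omega>)"
  using H_eq
proof eventually_elim
  case (elim \<omega>)
  have Z: "Z \<omega> = a * (H \<omega> - \<theta>)" using elim a_pos by simp
  have "\<bar>max 0 (H \<omega>) - \<theta>\<bar> \<le> \<bar>H \<omega> - \<theta>\<bar>" using theta_pos by (simp add: max_def)
  then have "\<bar>a * (max 0 (H \<omega>) - \<theta>)\<bar> \<le> \<bar>Z \<omega>\<bar>"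
    unfolding Z abs_mult using a_pos by (intro mult_left_mono) auto
  moreover have "a * (max 0 (H \<omega>) - \<theta>) = Z \<omega>" if "- (\<theta> * a) < Z \<omega>"
  proof -
    have "a * 0 < a * H \<omega>" using that unfolding Z by (simp add: algebra_simps)
    then have "H \<omega> > 0" using a_pos by (simp add: zero_less_mult_iff)
    then show ?thesis by (simp add: Z max_def)
  qed
  ultimately show ?case by blast
qed

lemma prob_error_le:
  assumes "\<epsilon> > 0"
  shows "prob {\<omega>\<in>space M. \<bar>max 0 (H \<omega>) - \<theta>\<bar> > \<epsilon>} \<le> 1 / (\<epsilon> * a)\<^sup>2"
proof -
  have "prob {\<omega>\<in>space M. \<bar>max 0 (H \<omega>) - \<theta>\<bar> > \<epsilon>} \<le> prob {\<omega>\<in>space M. \<epsilon> * a \<le> \<bar>Z \<omega>\<bar>}"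
  proof (rule finite_measure_mono_AE)
    show "AE \<omega> in M. \<omega> \<in> {\<omega>\<in>space M. \<bar>max 0 (H \<omega>) - \<theta>\<bar> > \<epsilon>} \<longrightarrow> \<omega> \<in> {\<omega>\<in>space M. \<epsilon> * a \<le> \<bar>Z \<omega>\<bar>}"
      using scaled_error_cases
    proof eventually_elim
      case (elim \<omega>)
      have "\<epsilon> * a \<le> \<bar>Z \<omega>\<bar>" if "\<epsilon> < \<bar>max 0 (H \<omega>) - \<theta>\<bar>"
      proof -
        have "\<epsilon> * a \<le> a * \<bar>max 0 (H \<omega>) - \<theta>\<bar>" using that a_pos by simp
        also have "\<dots> \<le> \<bar>Z \<omega>\<bar>" using elim a_pos by (simp add: abs_mult)
        finally show ?thesis .
      qed
      then show ?case by auto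
    qed
  qed measurable
  also have "\<dots> \<le> 1 / (\<epsilon> * a)\<^sup>2" using assms a_pos by (intro std_normal_tail Z_normal) simp
  finally show ?thesis .
qed

text \<open>Up to a null set the scaled error can differ from \<open>Z\<close> only where the truncation is active,
  whence a bound in which \<open>\<epsilon>\<close> does not occur.\<close>
lemma prob_scaled_error_noise_le:
  assumes Z': "AE \<omega> in M. Z' \<omega> = Z \<omega>" and \<epsilon>: "\<epsilon> \<ge> 0"
  shows "prob {\<omega>\<in>space M. \<bar>a * (max 0 (H \<omega>) - \<theta>) - Z' \<omega>\<bar> > \<epsilon>} \<le> 1 / (\<theta> * a)\<^sup>2"
proof -
  have "prob {\<omega>\<in>space M. \<bar>a * (max 0 (H \<omega>) - \<theta>) - Z' \<omega>\<bar> > \<epsilon>} \<le> prob {\<omega>\<in>space M. \<theta> * a \<le> \<bar>Z \<omega>\<bar>}"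
  proof (rule finite_measure_mono_AE)
    show "AE \<omega> in M. \<omega> \<in> {\<omega>\<in>space M. \<bar>a * (max 0 (H \<omega>) - \<theta>) - Z' \<omega>\<bar> > \<epsilon>} \<longrightarrow>
        \<omega> \<in> {\<omega>\<in>space M. \<theta> * a \<le> \<bar>Z \<omega>\<bar>}"
      using scaled_error_cases Z'
    proof eventually_elim
      case (elim \<omega>)
      then have "- (\<theta> * a) < Z \<omega> \<Longrightarrow> \<bar>a * (max 0 (H \<omega>) - \<theta>) - Z' \<omega>\<bar> = 0" by simp
      then show ?case using \<epsilon> by fastforce
    qed
  qed measurable
  also have "\<dots> \<le> 1 / (\<theta> * a)\<^sup>2" using theta_pos a_pos by (intro std_normal_tail Z_normal) simp
  finally show ?thesis .
qed

lemma expectation_scaled_error_le: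
  fixes g :: "real \<Rightarrow> real"
  assumes g [measurable]: "g \<in> borel_measurable borel" and K: "\<And>x. \<bar>g x\<bar> \<le> K"
  shows "\<bar>expectation (\<lambda>\<omega>. g (a * (max 0 (H \<omega>) - \<theta>))) - expectation (\<lambda>\<omega>. g (Z \<omega>))\<bar>
    \<le> 2 * K * (1 / (\<theta> * a)\<^sup>2)"
proof -
  let ?E = "\<lambda>\<omega>. a * (max 0 (H \<omega>) - \<theta>)" and ?A = "{\<omega>\<in>space M. \<theta> * a \<le> \<bar>Z \<omega>\<bar>}"
  have K0: "0 \<le> K" using K[of 0] by linarith
  have int: "integrable M (\<lambda>\<omega>. g (?E \<omega>))" "integrable M (\<lambda>\<omega>. g (Z \<omega>))"
    by (rule integrable_const_bound[of _ K]; use K in simp)+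
  have "\<bar>expectation (\<lambda>\<omega>. g (?E \<omega>)) - expectation (\<lambda>\<omega>. g (Z \<omega>))\<bar> =
      \<bar>expectation (\<lambda>\<omega>. g (?E \<omega>) - g (Z \<omega>))\<bar>"
    using int by simp
  also have "\<dots> \<le> expectation (\<lambda>\<omega>. \<bar>g (?E \<omega>) - g (Z \<omega>)\<bar>)"
    by (rule integral_abs_bound)
  also have "\<dots> \<le> expectation (\<lambda>\<omega>. 2 * K * indicator ?A \<omega>)"
  proof (rule integral_mono_AE)
    show "AE \<omega> in M. \<bar>g (?E \<omega>) - g (Z \<omega>)\<bar> \<le> 2 * K * indicator ?A \<omega>"
      using scaled_error_cases AE_space
    proof eventually_elim
      case (elim \<omega>)
      show ?case
      proof (cases "\<theta> * a \<le> \<bar>Z \<omega>\<bar>")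
        case True
        then have "indicator ?A \<omega> = (1::real)" using elim by simp
        then show ?thesis using K[of "?E \<omega>"] K[of "Z \<omega>"] by simp
      next
        case False
        then have "- (\<theta> * a) < Z \<omega>" by linarith
        then have "?E \<omega> = Z \<omega>" using elim by simp
        then show ?thesis using K0 by simp
      qed
    qed
    have "?A \<in> events" by measurable
    then show "integrable M (\<lambda>\<omega>. 2 * K * indicator ?A \<omega>)"
      by (intro integrable_mult_right integrable_real_indicator) (simp_all add: less_top[symmetric])
  qed (use int in simp)
  also have "\<dots> = 2 * K * prob ?A" by simp
  also have "\<dots> \<le> 2 * K * (1 / (\<theta> * a)\<^sup>2)"
    using theta_pos a_pos K0 by (intro mult_left_mono std_normal_tail Z_normal) simp_all
  finally show ?thesis .
qed

text \<open>The truncation never increases the error and losses are monotone in the absolute error, so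
  the risk is at most the Gaussian one; dropping the event on which the truncation is active gives the
  lower bound. The variable \<open>\<xi>\<close> has the law of \<open>Z\<close> but does not depend on \<open>a\<close>, which makes the
  bounds for different \<open>a\<close> comparable.\<close>
lemma nn_integral_loss_bounds:
  fixes l :: "real \<Rightarrow> real"
  assumes l: "l \<in> loss_functions" and \<xi>: "distributed M lborel \<xi> std_normal_density"
  shows "(\<integral>\<^sup>+ \<omega>. ennreal (l (a * (max 0 (H \<omega>) - \<theta>))) \<partial>M) \<le> (\<integral>\<^sup>+ \<omega>. ennreal (l (\<xi> \<omega>)) \<partial>M)"
    and "(\<integral>\<^sup>+ \<omega>. ennreal (l (\<xi> \<omega>) * indicator {- (\<theta> * a)<..} (\<xi> \<omega>)) \<partial>M) \<le>
      (\<integral>\<^sup>+ \<omega>. ennreal (l (a * (max 0 (H \<omega>) - \<theta>))) \<partial>M)"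
proof -
  have l_meas [measurable]: "l \<in> borel_measurable borel"
    and l_mono: "mono_on {0..} l" and l_sym: "\<And>x. l (- x) = l x" and l_nn: "\<And>x. 0 \<le> l x"
    using l by (auto simp: loss_functions_def)
  have l_abs: "l x = l \<bar>x\<bar>" for x using l_sym[of x] by (simp add: abs_if)
  have l_le: "l x \<le> l y" if "\<bar>x\<bar> \<le> \<bar>y\<bar>" for x y
    unfolding l_abs[of x] l_abs[of y] using that by (intro mono_onD[OF l_mono]) auto
  have "(\<integral>\<^sup>+ \<omega>. ennreal (l (a * (max 0 (H \<omega>) - \<theta>))) \<partial>M) \<le> (\<integral>\<^sup>+ \<omega>. ennreal (l (Z \<omega>)) \<partial>M)"
    by (rule nn_integral_mono_AE) (use scaled_error_cases in eventually_elim, auto intro!: ennreal_leI l_le)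
  also have "\<dots> = (\<integral>\<^sup>+ \<omega>. ennreal (l (\<xi> \<omega>)) \<partial>M)"
    by (rule distributed_nn_integral_eq[OF Z_normal \<xi>]) simp
  finally show "(\<integral>\<^sup>+ \<omega>. ennreal (l (a * (max 0 (H \<omega>) - \<theta>))) \<partial>M) \<le> (\<integral>\<^sup>+ \<omega>. ennreal (l (\<xi> \<omega>)) \<partial>M)" .
  have "(\<integral>\<^sup>+ \<omega>. ennreal (l (\<xi> \<omega>) * indicator {- (\<theta> * a)<..} (\<xi> \<omega>)) \<partial>M) =
      (\<integral>\<^sup>+ \<omega>. ennreal (l (Z \<omega>) * indicator {- (\<theta> * a)<..} (Z \<omega>)) \<partial>M)"
    by (rule distributed_nn_integral_eq[OF \<xi> Z_normal]) simp
  also have "\<dots> \<le> (\<integral>\<^sup>+ \<omega>. ennreal (l (a * (max 0 (H \<omega>) - \<theta>))) \<partial>M)"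
    by (rule nn_integral_mono_AE) (use scaled_error_cases in eventually_elim,
        auto simp: indicator_def l_nn intro!: ennreal_leI)
  finally show "(\<integral>\<^sup>+ \<omega>. ennreal (l (\<xi> \<omega>) * indicator {- (\<theta> * a)<..} (\<xi> \<omega>)) \<partial>M) \<le>
      (\<integral>\<^sup>+ \<omega>. ennreal (l (a * (max 0 (H \<omega>) - \<theta>))) \<partial>M)" .
qed

end

text \<open>Fatou's lemma: every point eventually lies above the truncation level. As nonnegative
  integrals are used, an infinite limit is covered as well.\<close>
lemma nn_integral_truncated_liminf:
  fixes a :: "nat \<Rightarrow> real"
  assumes [measurable]: "l \<in> borel_measurable borel" "\<xi> \<in> borel_measurable M"
    and a: "filterlim a at_top sequentially"
  shows "(\<integral>\<^sup>+ \<omega>. ennreal (l (\<xi> \<omega>)) \<partial>M) \<le>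
    liminf (\<lambda>N. \<integral>\<^sup>+ \<omega>. ennreal (l (\<xi> \<omega>) * indicator {- a N<..} (\<xi> \<omega>)) \<partial>M)"
proof -
  have "ennreal (l (\<xi> \<omega>)) \<le> liminf (\<lambda>N. ennreal (l (\<xi> \<omega>) * indicator {- a N<..} (\<xi> \<omega>)))" for \<omega>
  proof (rule Liminf_bounded)
    have "\<forall>\<^sub>F N in sequentially. - \<xi> \<omega> < a N"
      using a by (simp add: filterlim_at_top_dense)
    then show "\<forall>\<^sub>F N in sequentially. ennreal (l (\<xi> \<omega>)) \<le> ennreal (l (\<xi> \<omega>) * indicator {- a N<..} (\<xi> \<omega>))"
      by eventually_elim (auto simp: indicator_def)
  qed
  then have "(\<integral>\<^sup>+ \<omega>. ennreal (l (\<xi> \<omega>)) \<partial>M) \<le>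
      (\<integral>\<^sup>+ \<omega>. liminf (\<lambda>N. ennreal (l (\<xi> \<omega>) * indicator {- a N<..} (\<xi> \<omega>))) \<partial>M)"
    by (rule nn_integral_mono)
  also have "\<dots> \<le> liminf (\<lambda>N. \<integral>\<^sup>+ \<omega>. ennreal (l (\<xi> \<omega>) * indicator {- a N<..} (\<xi> \<omega>)) \<partial>M)"
    by (rule nn_integral_liminf) measurable
  finally show ?thesis .
qed

lemma filterlim_sum_at_top:
  fixes f :: "nat \<Rightarrow> real"
  assumes nn: "\<And>k. k \<ge> 1 \<Longrightarrow> 0 \<le> f k" and ev: "\<forall>\<^sub>F k in sequentially. c \<le> f k" and c: "0 < c"
  shows "filterlim (\<lambda>N. \<Sum>k=1..N. f k) at_top sequentially"
proof -
  obtain K where K: "\<And>k. k \<ge> K \<Longrightarrow> c \<le> f k" using ev by (auto simp: eventually_sequentially)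
  have "c * (real N - real K) \<le> (\<Sum>k=1..N. f k)" for N
  proof (induction N)
    case 0
    show ?case using c by (simp add: mult_nonneg_nonpos)
  next
    case (Suc N)
    show ?case
    proof (cases "Suc N \<ge> K")
      case True
      then show ?thesis using Suc K[OF True] by (simp add: algebra_simps)
    next
      case False
      then have "c * (real (Suc N) - real K) \<le> 0" using c by (intro mult_nonneg_nonpos) auto
      also have "0 \<le> (\<Sum>k=1..Suc N. f k)" using nn by (intro sum_nonneg) simp
      finally show ?thesis .
    qed
  qed
  moreover have "filterlim (\<lambda>N. c * (real N - real K)) at_top sequentially"
    using filterlim_tendsto_pos_mult_at_top[OF tendsto_const c
        filterlim_tendsto_add_at_top[OF tendsto_const filterlim_real_sequentially, of "- real K"]]
    by simp
  ultimately show ?thesis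
    by (intro filterlim_at_top_mono[of _ _ "\<lambda>N. \<Sum>k=1..N. f k"]) auto
qed

lemma tendsto_SUP_ennreal_0:
  fixes x :: "'b \<Rightarrow> nat \<Rightarrow> real"
  assumes le: "\<And>\<theta> N. \<theta> \<in> B \<Longrightarrow> N \<ge> 1 \<Longrightarrow> x \<theta> N \<le> c N" and c: "c \<longlonglongrightarrow> 0"
  shows "(\<lambda>N. SUP \<theta>\<in>B. ennreal (x \<theta> N)) \<longlonglongrightarrow> 0"
proof (rule tendsto_sandwich[OF _ _ tendsto_const])
  show "\<forall>\<^sub>F N in sequentially. 0 \<le> (SUP \<theta>\<in>B. ennreal (x \<theta> N))" by simp
  show "\<forall>\<^sub>F N in sequentially. (SUP \<theta>\<in>B. ennreal (x \<theta> N)) \<le> ennreal (c N)"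
    using eventually_ge_at_top[of 1] by eventually_elim (auto intro!: SUP_least ennreal_leI le)
  show "(\<lambda>N. ennreal (c N)) \<longlonglongrightarrow> 0" using tendsto_ennrealI[OF c] by simp
qed

section \<open>The estimator in the diagonal model\<close>

locale diagonal_spde_model = stochastic_basis M F
  for M :: "'a measure" and F :: "real \<Rightarrow> 'a measure" +
  fixes w :: "nat \<Rightarrow> real \<Rightarrow> 'a \<Rightarrow> real" and u0 :: "nat \<Rightarrow> 'a \<Rightarrow> real"
    and \<mu> q :: "nat \<Rightarrow> real" and \<sigma> T :: real
  assumes bm: "indep_brownian_motions {1..} w"
    and mu_pos: "k \<ge> 1 \<Longrightarrow> \<mu> k > 0" and mu_lim: "filterlim \<mu> at_top sequentially"
    and q_pos: "k \<ge> 1 \<Longrightarrow> q k > 0"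
    and sigma_pos: "\<sigma> > 0" and T_pos: "T > 0"
    and u0_measurable: "k \<ge> 1 \<Longrightarrow> u0 k \<in> borel_measurable (F 0)"
    and u0_nonzero: "k \<ge> 1 \<Longrightarrow> AE \<omega> in M. u0 k \<omega> \<noteq> 0"
    and wellposed: "\<exists>\<theta>'>0. \<exists>N\<^sub>0\<ge>1. \<exists>c>0. \<forall>k\<ge>N\<^sub>0. 2 * \<theta>' - \<sigma>\<^sup>2 * (q k)\<^sup>2 / \<mu> k \<ge> c"
begin

abbreviation I where "I \<equiv> fisher_info T \<sigma> \<mu> q"

abbreviation H where "H \<theta> \<equiv> theta_hat M T \<mu> q (fourier_mode \<sigma> \<mu> q u0 w \<theta>)"

text \<open>This is \<open>xi_approx\<close> with \<open>w k T\<close> replaced by the increment over \<open>[0, T]\<close>. The two agree almost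
  surely, but the law of an increment is given directly by the definition of Brownian motion.\<close>
definition noise :: "nat \<Rightarrow> 'a \<Rightarrow> real" where
  "noise N \<omega> = - (1 / (\<sigma> * sqrt (I N))) * (\<Sum>k=1..N. \<mu> k / q k * (w k T \<omega> - w k 0 \<omega>))"

lemma fisher_info_pos:
  assumes "N \<ge> 1"
  shows "I N > 0"
proof -
  have "(\<Sum>k=1..N. (\<mu> k)\<^sup>2 / (q k)\<^sup>2) > 0"
    using assms mu_pos q_pos by (intro sum_pos divide_pos_pos zero_less_power) auto
  then show ?thesis using T_pos sigma_pos by (simp add: fisher_info_def)
qed

text \<open>For large \<open>k\<close> the well-posedness condition bounds \<open>(q k)\<^sup>2\<close> by a multiple of \<open>\<mu> k\<close>, so that the summand
  \<open>(\<mu> k)\<^sup>2 / (q k)\<^sup>2\<close> grows at least like \<open>\<mu> k\<close>.\<close>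
lemma fisher_info_at_top: "filterlim I at_top sequentially"
proof -
  obtain \<theta>' N0 c where t: "\<theta>' > 0" "N0 \<ge> 1" "c > 0"
    "\<And>k. k \<ge> N0 \<Longrightarrow> 2 * \<theta>' - \<sigma>\<^sup>2 * (q k)\<^sup>2 / \<mu> k \<ge> c"
    using wellposed by blast
  have "\<forall>\<^sub>F k in sequentially. 2 * \<theta>' / \<sigma>\<^sup>2 \<le> \<mu> k"
    using mu_lim by (simp add: filterlim_at_top)
  then have ev: "\<forall>\<^sub>F k in sequentially. 1 \<le> (\<mu> k)\<^sup>2 / (q k)\<^sup>2"
    using eventually_ge_at_top[of N0]
  proof eventually_elim
    case (elim k)
    have k: "\<mu> k > 0" "q k > 0" using mu_pos q_pos elim t(2) by auto
    have "\<sigma>\<^sup>2 * (q k)\<^sup>2 / \<mu> k \<le> 2 * \<theta>'" using t(3) t(4)[OF elim(2)] by linarith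
    then have "\<sigma>\<^sup>2 * (q k)\<^sup>2 \<le> 2 * \<theta>' * \<mu> k" using k by (simp add: field_simps)
    also have "\<dots> \<le> (\<sigma>\<^sup>2 * \<mu> k) * \<mu> k"
      using elim(1) k sigma_pos by (intro mult_right_mono) (auto simp: field_simps)
    finally have "(q k)\<^sup>2 \<le> (\<mu> k)\<^sup>2" using sigma_pos by (simp add: power2_eq_square)
    then show ?case using k by simp
  qed
  have "filterlim (\<lambda>N. \<Sum>k=1..N. (\<mu> k)\<^sup>2 / (q k)\<^sup>2) at_top sequentially"
    by (rule filterlim_sum_at_top[OF _ ev]) auto
  then show ?thesis
    unfolding fisher_info_def[abs_def] using T_pos sigma_pos
    by (intro filterlim_tendsto_pos_mult_at_top[OF tendsto_const]) auto
qed

lemma brownian: "k \<ge> 1 \<Longrightarrow> brownian_motion (w k)"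
  using bm unfolding indep_brownian_motions_def by auto

text \<open>The Fisher information is exactly the variance of the weighted sum of Brownian increments
  divided by \<open>\<sigma>\<^sup>2\<close>, so the normalised sum is standard normal for every \<open>N \<ge> 1\<close>, not only in the limit.\<close>
lemma noise_std_normal:
  assumes N: "N \<ge> 1"
  shows "distributed M lborel (noise N) std_normal_density"
proof -
  let ?V = "\<lambda>k \<omega>. \<mu> k / q k * (w k T \<omega> - w k 0 \<omega>)"
  have IN: "I N > 0" by (rule fisher_info_pos[OF N])
  have "indep_vars (\<lambda>_. \<Pi>\<^sub>M t\<in>{0..}. borel) (\<lambda>k \<omega>. \<lambda>t\<in>{0..}. w k t \<omega>) {1..N}"
    using bm unfolding indep_brownian_motions_def by (auto intro: indep_vars_subset)
  then have "indep_vars (\<lambda>_. borel)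
      (\<lambda>k \<omega>. \<mu> k / q k * ((\<lambda>t\<in>{0..}. w k t \<omega>) T - (\<lambda>t\<in>{0..}. w k t \<omega>) 0)) {1..N}"
  proof (rule indep_vars_compose2)
    have "T \<in> {0..}" "0 \<in> {0::real..}" using T_pos by auto
    then show "(\<lambda>f. \<mu> k / q k * (f T - f 0)) \<in> borel_measurable (\<Pi>\<^sub>M t\<in>{0..}. borel)" for k
      using measurable_component_singleton[of T "{0..}" "\<lambda>_. borel"]
        measurable_component_singleton[of "0::real" "{0..}" "\<lambda>_. borel"]
      by (intro borel_measurable_times borel_measurable_const borel_measurable_diff) auto
  qed
  then have ind: "indep_vars (\<lambda>_. borel) ?V {1..N}" using T_pos by simp
  have V: "distributed M lborel (?V k) (normal_density 0 (\<mu> k / q k * sqrt T))"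
    and V_pos: "0 < \<mu> k / q k * sqrt T" if k: "k \<in> {1..N}" for k
  proof -
    have c: "\<mu> k / q k > 0" using mu_pos[of k] q_pos[of k] k by simp
    then show "0 < \<mu> k / q k * sqrt T" using T_pos by (intro mult_pos_pos) simp_all
    have "distributed M lborel (\<lambda>\<omega>. w k T \<omega> - w k 0 \<omega>) (normal_density 0 (sqrt T))"
      using brownian_motionD(4)[OF brownian, of k T 0] k T_pos by simp
    from normal_density_affine[OF this, of "\<mu> k / q k" 0]
    show "distributed M lborel (?V k) (normal_density 0 (\<mu> k / q k * sqrt T))"
      unfolding abs_of_pos[OF c] using T_pos mu_pos[of k] q_pos[of k] k by simp
  qed
  let ?s = "sqrt (\<Sum>k=1..N. (\<mu> k / q k * sqrt T)\<^sup>2)"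
  have s2: "(\<Sum>k=1..N. (\<mu> k / q k * sqrt T)\<^sup>2) = \<sigma>\<^sup>2 * I N"
    using T_pos sigma_pos
    by (simp add: fisher_info_def power_mult_distrib power_divide sum_distrib_left mult.commute)
  have s: "?s = \<sigma> * sqrt (I N)"
    unfolding s2 using sigma_pos by (simp add: real_sqrt_mult)
  have "distributed M lborel (\<lambda>\<omega>. \<Sum>k=1..N. ?V k \<omega>) (normal_density (\<Sum>k=1..N. 0) ?s)"
    by (rule sum_indep_normal[OF _ _ ind V_pos V]) (use N in auto)
  then have "distributed M lborel (\<lambda>\<omega>. \<Sum>k=1..N. ?V k \<omega>) (normal_density 0 (\<sigma> * sqrt (I N)))"
    unfolding s by simp
  from normal_density_affine[OF this, of "- (1 / (\<sigma> * sqrt (I N)))" 0]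
  show ?thesis
    using IN sigma_pos by (simp add: noise_def[abs_def])
qed

lemma xi_approx_eq_noise: "AE \<omega> in M. xi_approx T \<sigma> \<mu> q w N \<omega> = noise N \<omega>"
proof -
  have "AE \<omega> in M. \<forall>k\<in>{1..N}. w k 0 \<omega> = 0"
    using brownian_motionD(3)[OF brownian] by (intro AE_finite_allI) auto
  then show ?thesis by eventually_elim (simp add: xi_approx_def noise_def)
qed

lemma fourier_mode_eq_geometric_bm:
  "fourier_mode \<sigma> \<mu> q u0 w \<theta> k = geometric_bm (\<theta> * \<mu> k) (\<sigma> * q k) (u0 k) (w k)"
  by (intro ext) (simp add: fourier_mode_def geometric_bm_def power_mult_distrib)

text \<open>Since the integral of \<open>du / u\<close> over the \<open>k\<close>-th mode is \<open>\<sigma> * q k * (w k T - w k 0) - \<theta> * \<mu> k * T\<close>,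
  the drift parts of the weighted sum add up to \<open>\<theta>\<close> after normalisation and the martingale parts
  to the noise. The chosen versions of the integrals are only determined almost surely; finitely
  many null sets are discarded.\<close>
lemma
  assumes N: "N \<ge> 1"
  shows theta_hat_measurable: "H \<theta> N \<in> borel_measurable M"
    and theta_hat_eq: "AE \<omega> in M. H \<theta> N \<omega> = \<theta> + noise N \<omega> / sqrt (I N)"
proof -
  let ?J = "\<lambda>k. ito_integral M T (\<lambda>t \<omega>. 1 / fourier_mode \<sigma> \<mu> q u0 w \<theta> k t \<omega>) (fourier_mode \<sigma> \<mu> q u0 w \<theta> k)"
  have J: "?J k \<in> borel_measurable M" "AE \<omega> in M. ?J k \<omega> = \<sigma> * q k * (w k T \<omega> - w k 0 \<omega>) - \<theta> * \<mu> k * T"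
    if "k \<in> {1..N}" for k
    using ito_integral_geometric_bm[OF brownian T_pos measurable_from_subalg[OF subalgebra_F u0_measurable] u0_nonzero,
        where m = "\<theta> * \<mu> k" and b = "\<sigma> * q k", of k k] that
    unfolding fourier_mode_eq_geometric_bm by auto
  show "H \<theta> N \<in> borel_measurable M"
    unfolding theta_hat_def[abs_def] using J(1)
    by (intro borel_measurable_divide borel_measurable_uminus borel_measurable_sum
        borel_measurable_times borel_measurable_const) auto
  let ?S = "\<Sum>k=1..N. (\<mu> k)\<^sup>2 / (q k)\<^sup>2"
  have IN: "I N > 0" by (rule fisher_info_pos[OF N])
  have TS: "T * ?S = \<sigma>\<^sup>2 * I N" using sigma_pos by (simp add: fisher_info_def)
  have "AE \<omega> in M. \<forall>k\<in>{1..N}. ?J k \<omega> = \<sigma> * q k * (w k T \<omega> - w k 0 \<omega>) - \<theta> * \<mu> k * T"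
    using J(2) by (intro AE_finite_allI) auto
  then show "AE \<omega> in M. H \<theta> N \<omega> = \<theta> + noise N \<omega> / sqrt (I N)"
  proof eventually_elim
    case (elim \<omega>)
    let ?W = "\<Sum>k=1..N. \<mu> k / q k * (w k T \<omega> - w k 0 \<omega>)"
    have "(\<Sum>k=1..N. \<mu> k / (q k)\<^sup>2 * ?J k \<omega>) =
        (\<Sum>k=1..N. \<sigma> * (\<mu> k / q k * (w k T \<omega> - w k 0 \<omega>)) - \<theta> * T * ((\<mu> k)\<^sup>2 / (q k)\<^sup>2))"
    proof (rule sum.cong[OF refl])
      fix k assume k: "k \<in> {1..N}"
      then have "q k \<noteq> 0" using q_pos[of k] by auto
      then show "\<mu> k / (q k)\<^sup>2 * ?J k \<omega> =
          \<sigma> * (\<mu> k / q k * (w k T \<omega> - w k 0 \<omega>)) - \<theta> * T * ((\<mu> k)\<^sup>2 / (q k)\<^sup>2)"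
        unfolding elim[rule_format, OF k] by (simp add: field_simps power2_eq_square)
    qed
    also have "\<dots> = \<sigma> * ?W - \<theta> * (T * ?S)"
      by (simp only: sum_subtractf sum_distrib_left mult.assoc)
    finally have "H \<theta> N \<omega> = - (\<sigma> * ?W - \<theta> * (\<sigma>\<^sup>2 * I N)) / (\<sigma>\<^sup>2 * I N)"
      unfolding theta_hat_def TS by simp
    also have "\<dots> = \<theta> - ?W / (\<sigma> * I N)"
      using IN sigma_pos by (simp add: field_simps power2_eq_square)
    also have "\<dots> = \<theta> + noise N \<omega> / sqrt (I N)"
      using IN by (simp add: noise_def)
    finally show ?case .
  qed
qed

lemma theta_hat_gaussian_location_estimate:
  assumes "\<theta> > 0" "N \<ge> 1"
  shows "gaussian_location_estimate M (H \<theta> N) (noise N) (sqrt (I N)) \<theta>"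
  by unfold_locales
    (use theta_hat_measurable theta_hat_eq noise_std_normal fisher_info_pos assms in auto)

end

lemma theta_mle_eq_max: "theta_mle M T \<mu> q u N \<omega> = max 0 (theta_hat M T \<mu> q u N \<omega>)"
  by (auto simp: theta_mle_def indicator_def max_def)

section \<open>Consistency, asymptotic normality and asymptotic efficiency\<close>

theorem theorem3p2:
  fixes M :: "'a measure" and F :: "real \<Rightarrow> 'a measure"
    and w :: "nat \<Rightarrow> real \<Rightarrow> 'a \<Rightarrow> real" and u0 :: "nat \<Rightarrow> 'a \<Rightarrow> real"
    and \<mu> q :: "nat \<Rightarrow> real" and \<sigma> T :: real
    and B :: "real set" and \<xi> :: "'a \<Rightarrow> real"
  defines "u \<equiv> fourier_mode \<sigma> \<mu> q u0 w"
    and "I \<equiv> fisher_info T \<sigma> \<mu> q"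
    and "mle \<equiv> theta_mle M T \<mu> q"
  assumes basis: "stochastic_basis M F"
    and bm: "stochastic_basis.indep_brownian_motions M F {1..} w"
    and mu_pos: "\<forall>k\<ge>1. \<mu> k > 0" and mu_lim: "filterlim \<mu> at_top sequentially"
    and q_pos: "\<forall>k\<ge>1. q k > 0"
    and "\<sigma> > 0" and "T > 0"
    and u0_meas: "\<forall>k\<ge>1. u0 k \<in> borel_measurable (F 0)"
    and u0_nz: "\<forall>k\<ge>1. AE \<omega> in M. u0 k \<omega> \<noteq> 0"
    and wellposed: "\<exists>\<theta>'>0. \<exists>N\<^sub>0\<ge>1. \<exists>c>0. \<forall>k\<ge>N\<^sub>0. 2 * \<theta>' - \<sigma>\<^sup>2 * (q k)\<^sup>2 / \<mu> k \<ge> c"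
    and xi: "distributed M lborel \<xi> std_normal_density"
    and B: "compact B" "B \<subseteq> {0<..}"
  shows
    "(\<forall>\<epsilon>>0. (\<lambda>N. SUP \<theta>\<in>B. ennreal (\<P>(\<omega> in M. \<bar>mle (u \<theta>) N \<omega> - \<theta>\<bar> > \<epsilon>)))
        \<longlonglongrightarrow> 0) \<and>
     (\<forall>g :: real \<Rightarrow> real. continuous_on UNIV g \<and> bounded (range g) \<longrightarrow>
        (\<lambda>N. SUP \<theta>\<in>B. ennreal
          \<bar>(\<integral>\<omega>. g (sqrt (I N) * (mle (u \<theta>) N \<omega> - \<theta>)) \<partial>M) - (\<integral>\<omega>. g (\<xi> \<omega>) \<partial>M)\<bar>)
        \<longlonglongrightarrow> 0) \<and>
     (\<forall>\<epsilon>>0. (\<lambda>N. SUP \<theta>\<in>B. ennreal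
          (\<P>(\<omega> in M. \<bar>sqrt (I N) * (mle (u \<theta>) N \<omega> - \<theta>) - xi_approx T \<sigma> \<mu> q w N \<omega>\<bar> > \<epsilon>)))
        \<longlonglongrightarrow> 0) \<and>
     (\<forall>l\<in>poly_loss_functions. \<forall>\<theta>\<^sub>0\<in>B.
        ((\<lambda>\<delta>. liminf (\<lambda>N. SUP \<theta>\<in>{\<theta>. 0 < \<theta> \<and> \<bar>\<theta> - \<theta>\<^sub>0\<bar> < \<delta>}.
            \<integral>\<^sup>+ \<omega>. ennreal (l (sqrt (I N) * (mle (u \<theta>) N \<omega> - \<theta>))) \<partial>M))
          \<longlongrightarrow> (\<integral>\<^sup>+ \<omega>. ennreal (l (\<xi> \<omega>)) \<partial>M)) (at_right 0))"
proof -
  interpret diagonal_spde_model M F w u0 \<mu> q \<sigma> T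
    using basis bm mu_pos mu_lim q_pos \<open>\<sigma> > 0\<close> \<open>T > 0\<close> u0_meas u0_nz wellposed
    by (intro diagonal_spde_model.intro diagonal_spde_model_axioms.intro) auto
  have mle: "mle (u \<theta>) N \<omega> = max 0 (theta_hat M T \<mu> q (fourier_mode \<sigma> \<mu> q u0 w \<theta>) N \<omega>)" for \<theta> N \<omega>
    by (simp add: mle_def u_def theta_mle_eq_max)
  have est: "gaussian_location_estimate M (theta_hat M T \<mu> q (fourier_mode \<sigma> \<mu> q u0 w \<theta>) N)
      (noise N) (sqrt (I N)) \<theta>" if "\<theta> > 0" "N \<ge> 1" for \<theta> N
    unfolding I_def by (rule theta_hat_gaussian_location_estimate[OF that])
  have a_lim: "filterlim (\<lambda>N. sqrt (I N)) at_top sequentially"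
    unfolding I_def by (rule filterlim_compose[OF sqrt_at_top fisher_info_at_top])
  have bound_lim: "(\<lambda>N. C * (1 / (c * sqrt (I N))\<^sup>2)) \<longlonglongrightarrow> 0" if "c > 0" for c C :: real
  proof -
    have "filterlim (\<lambda>N. (c * sqrt (I N))\<^sup>2) at_top sequentially"
      by (intro filterlim_pow_at_top filterlim_tendsto_pos_mult_at_top[OF tendsto_const that a_lim]) simp
    then have "(\<lambda>N. 1 / (c * sqrt (I N))\<^sup>2) \<longlonglongrightarrow> 0"
      by (intro tendsto_divide_0[OF tendsto_const] filterlim_at_top_imp_at_infinity)
    from tendsto_mult_right_zero[OF this, of C] show ?thesis .
  qed
  \<comment> \<open>A compact set of positive parameters stays away from 0, so the truncation error
    \<open>1 / (\<theta> * sqrt (I N))\<^sup>2\<close> vanishes uniformly.\<close>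
  obtain b where b: "b > 0" "\<And>\<theta>. \<theta> \<in> B \<Longrightarrow> b \<le> \<theta>"
  proof (cases "B = {}")
    case False
    then obtain b where "b \<in> B" "\<And>\<theta>. \<theta> \<in> B \<Longrightarrow> b \<le> \<theta>"
      using compact_attains_inf[OF B(1)] by blast
    then show ?thesis using that B(2) by auto
  qed (use that[of 1] in auto)
  have B_pos: "\<theta> > 0" if "\<theta> \<in> B" for \<theta> using that B(2) by auto
  have b_le: "1 / (\<theta> * sqrt (I N))\<^sup>2 \<le> 1 / (b * sqrt (I N))\<^sup>2" if "\<theta> \<in> B" "N \<ge> 1" for \<theta> N
    using b(1) b(2)[OF that(1)] fisher_info_pos[OF that(2)]
    by (intro divide_left_mono power_mono mult_right_mono mult_pos_pos) (auto simp: I_def)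
  show ?thesis
  proof (intro conjI allI impI ballI)
    fix \<epsilon> :: real assume \<epsilon>: "\<epsilon> > 0"
    show "(\<lambda>N. SUP \<theta>\<in>B. ennreal (\<P>(\<omega> in M. \<bar>mle (u \<theta>) N \<omega> - \<theta>\<bar> > \<epsilon>))) \<longlonglongrightarrow> 0"
      unfolding mle
      by (rule tendsto_SUP_ennreal_0[OF _ bound_lim[OF \<epsilon>, of 1]])
        (use gaussian_location_estimate.prob_error_le[OF est[OF B_pos] \<epsilon>] in simp)
    show "(\<lambda>N. SUP \<theta>\<in>B. ennreal
          (\<P>(\<omega> in M. \<bar>sqrt (I N) * (mle (u \<theta>) N \<omega> - \<theta>) - xi_approx T \<sigma> \<mu> q w N \<omega>\<bar> > \<epsilon>))) \<longlonglongrightarrow> 0"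
      unfolding mle
    proof (rule tendsto_SUP_ennreal_0[OF _ bound_lim[OF b(1), of 1]])
      fix \<theta> N assume \<theta>: "\<theta> \<in> B" and N: "N \<ge> (1::nat)"
      from gaussian_location_estimate.prob_scaled_error_noise_le[OF est[OF B_pos[OF \<theta>] N] xi_approx_eq_noise, of \<epsilon>]
      show "\<P>(\<omega> in M. \<bar>sqrt (I N) * (max 0 (theta_hat M T \<mu> q (fourier_mode \<sigma> \<mu> q u0 w \<theta>) N \<omega>) - \<theta>)
          - xi_approx T \<sigma> \<mu> q w N \<omega>\<bar> > \<epsilon>) \<le> 1 * (1 / (b * sqrt (I N))\<^sup>2)"
        using \<epsilon> b_le[OF \<theta> N] by linarith
    qed
  next
    fix g :: "real \<Rightarrow> real" assume g: "continuous_on UNIV g \<and> bounded (range g)"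
    then obtain K where K: "\<And>x. \<bar>g x\<bar> \<le> K" by (auto simp: bounded_iff)
    have K0: "K \<ge> 0" using K[of 0] by linarith
    have g_meas: "g \<in> borel_measurable borel" using g by (intro borel_measurable_continuous_onI) simp
    show "(\<lambda>N. SUP \<theta>\<in>B. ennreal
          \<bar>(\<integral>\<omega>. g (sqrt (I N) * (mle (u \<theta>) N \<omega> - \<theta>)) \<partial>M) - (\<integral>\<omega>. g (\<xi> \<omega>) \<partial>M)\<bar>) \<longlonglongrightarrow> 0"
      unfolding mle
    proof (rule tendsto_SUP_ennreal_0[OF _ bound_lim[OF b(1), of "2 * K"]])
      fix \<theta> N assume \<theta>: "\<theta> \<in> B" and N: "N \<ge> (1::nat)"
      have "(\<integral>\<omega>. g (\<xi> \<omega>) \<partial>M) = (\<integral>\<omega>. g (noise N \<omega>) \<partial>M)"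
        by (rule distributed_integral_eq[OF xi noise_std_normal[OF N] g_meas]) simp
      then have "\<bar>(\<integral>\<omega>. g (sqrt (I N) * (max 0 (theta_hat M T \<mu> q (fourier_mode \<sigma> \<mu> q u0 w \<theta>) N \<omega>) - \<theta>)) \<partial>M)
          - (\<integral>\<omega>. g (\<xi> \<omega>) \<partial>M)\<bar> \<le> 2 * K * (1 / (\<theta> * sqrt (I N))\<^sup>2)"
        using gaussian_location_estimate.expectation_scaled_error_le[OF est[OF B_pos[OF \<theta>] N] g_meas K] by simp
      also have "\<dots> \<le> 2 * K * (1 / (b * sqrt (I N))\<^sup>2)"
        using K0 b_le[OF \<theta> N] by (intro mult_left_mono) auto
      finally show "\<bar>(\<integral>\<omega>. g (sqrt (I N) * (max 0 (theta_hat M T \<mu> q (fourier_mode \<sigma> \<mu> q u0 w \<theta>) N \<omega>) - \<theta>)) \<partial>M)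
          - (\<integral>\<omega>. g (\<xi> \<omega>) \<partial>M)\<bar> \<le> 2 * K * (1 / (b * sqrt (I N))\<^sup>2)" .
    qed
  next
    fix l \<theta>\<^sub>0 assume "l \<in> poly_loss_functions" and "\<theta>\<^sub>0 \<in> B"
    then have l: "l \<in> loss_functions" and \<theta>\<^sub>0: "\<theta>\<^sub>0 > 0"
      using B(2) by (auto simp: poly_loss_functions_def)
    let ?r = "\<lambda>\<theta> N. \<integral>\<^sup>+ \<omega>. ennreal (l (sqrt (I N) * (mle (u \<theta>) N \<omega> - \<theta>))) \<partial>M"
    let ?L = "\<integral>\<^sup>+ \<omega>. ennreal (l (\<xi> \<omega>)) \<partial>M"
    have upper: "?r \<theta> N \<le> ?L" if "\<theta> > 0" "N \<ge> 1" for \<theta> N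
      unfolding mle by (rule gaussian_location_estimate.nn_integral_loss_bounds(1)[OF est[OF that] l xi])
    have "?L \<le> liminf (\<lambda>N. \<integral>\<^sup>+ \<omega>. ennreal (l (\<xi> \<omega>) * indicator {- (\<theta>\<^sub>0 * sqrt (I N))<..} (\<xi> \<omega>)) \<partial>M)"
    proof (rule nn_integral_truncated_liminf)
      show "l \<in> borel_measurable borel" using l by (simp add: loss_functions_def)
      show "\<xi> \<in> borel_measurable M" using distributed_measurable[OF xi] by simp
      show "filterlim (\<lambda>N. \<theta>\<^sub>0 * sqrt (I N)) at_top sequentially"
        by (rule filterlim_tendsto_pos_mult_at_top[OF tendsto_const \<theta>\<^sub>0 a_lim])
    qed
    also have "\<dots> \<le> liminf (?r \<theta>\<^sub>0)"
    proof (rule Liminf_mono)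
      show "\<forall>\<^sub>F N in sequentially.
          (\<integral>\<^sup>+ \<omega>. ennreal (l (\<xi> \<omega>) * indicator {- (\<theta>\<^sub>0 * sqrt (I N))<..} (\<xi> \<omega>)) \<partial>M) \<le> ?r \<theta>\<^sub>0 N"
        using eventually_ge_at_top[of 1] unfolding mle
        by eventually_elim (rule gaussian_location_estimate.nn_integral_loss_bounds(2)[OF est[OF \<theta>\<^sub>0] l xi])
    qed
    finally have lower: "?L \<le> liminf (?r \<theta>\<^sub>0)" .
    \<comment> \<open>The upper bound holds at every parameter and the lower one already at \<open>\<theta>\<^sub>0\<close>, so the expression
      does not depend on \<open>\<delta>\<close>.\<close>
    have "liminf (\<lambda>N. SUP \<theta>\<in>{\<theta>. 0 < \<theta> \<and> \<bar>\<theta> - \<theta>\<^sub>0\<bar> < \<delta>}. ?r \<theta> N) = ?L" if "\<delta> > 0" for \<delta>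
    proof (rule antisym)
      have "\<forall>\<^sub>F N in sequentially. (SUP \<theta>\<in>{\<theta>. 0 < \<theta> \<and> \<bar>\<theta> - \<theta>\<^sub>0\<bar> < \<delta>}. ?r \<theta> N) \<le> ?L"
        using eventually_ge_at_top[of 1] by eventually_elim (auto intro!: SUP_least upper)
      from Liminf_mono[OF this]
      show "liminf (\<lambda>N. SUP \<theta>\<in>{\<theta>. 0 < \<theta> \<and> \<bar>\<theta> - \<theta>\<^sub>0\<bar> < \<delta>}. ?r \<theta> N) \<le> ?L"
        by (simp add: Liminf_const)
      have "liminf (?r \<theta>\<^sub>0) \<le> liminf (\<lambda>N. SUP \<theta>\<in>{\<theta>. 0 < \<theta> \<and> \<bar>\<theta> - \<theta>\<^sub>0\<bar> < \<delta>}. ?r \<theta> N)"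
        using \<theta>\<^sub>0 that by (intro Liminf_mono always_eventually allI SUP_upper) auto
      then show "?L \<le> liminf (\<lambda>N. SUP \<theta>\<in>{\<theta>. 0 < \<theta> \<and> \<bar>\<theta> - \<theta>\<^sub>0\<bar> < \<delta>}. ?r \<theta> N)"
        using lower by (rule order_trans[rotated])
    qed
    then show "((\<lambda>\<delta>. liminf (\<lambda>N. SUP \<theta>\<in>{\<theta>. 0 < \<theta> \<and> \<bar>\<theta> - \<theta>\<^sub>0\<bar> < \<delta>}. ?r \<theta> N)) \<longlongrightarrow> ?L) (at_right 0)"
      by (intro tendsto_eventually eventually_at_rightI[of 0 1]) auto
  qed
qed

end
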